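(* Let $u:\mathbb{R}^n\to\mathbb{R}$ be a $C^{2}$ convex or concave solution of $$\sum_{i=1}^{n}\arctan\lambda_{i}=-u+\frac{1}{2}\sum_{i=1}^{n}x_{i}\frac{\partial u}{\partial x_{i}}\quad\text{on }\mathbb{R}^n,$$ where $\lambda_{i}=\lambda_i(x)$ $(i=1,2,\dots,n)$ are the eigenvalues of the Hessian $D^{2}u(x)$. Then $u$ must be a quadratic polynomial.
   Context: "Quadratic polynomial" means a polynomial of degree at most two (i.e. $D^2u$ is a constant matrix). *)

theory Defs
  imports "HOL-Analysis.Analysis" "HOL-Computational_Algebra.Polynomial"
begin

definition partial_deriv :: "'n::finite \<Rightarrow> (real ^ 'n \<Rightarrow> real) \<Rightarrow> real ^ 'n \<Rightarrow> real" where
  "partial_deriv i f x = deriv (\<lambda>t. f (x + t *\<^sub>R axis i 1)) 0"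

definition C1 :: "(real ^ 'n::finite \<Rightarrow> real) \<Rightarrow> bool" where
  "C1 f \<longleftrightarrow> (\<forall>x. f differentiable (at x)) \<and> (\<forall>i. continuous_on UNIV (partial_deriv i f))"

definition C2 :: "(real ^ 'n::finite \<Rightarrow> real) \<Rightarrow> bool" where
  "C2 f \<longleftrightarrow> C1 f \<and> (\<forall>i. C1 (partial_deriv i f))"

definition hessian :: "(real ^ 'n::finite \<Rightarrow> real) \<Rightarrow> real ^ 'n \<Rightarrow> real ^ 'n ^ 'n" where
  "hessian f x = (\<chi> i j. partial_deriv i (partial_deriv j f) x)"

definition char_polynomial :: "real ^ 'n::finite ^ 'n \<Rightarrow> real poly" where
  "char_polynomial A = det (\<chi> i j. (if i = j then [:0, 1:] else 0) - [:A $ i $ j:])"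

(* The family l lists the eigenvalues of A, repeated according to algebraic multiplicity
   (in an arbitrary order).  Every real symmetric matrix admits such a family. *)
definition eigenvalues_of :: "real ^ 'n::finite ^ 'n \<Rightarrow> ('n \<Rightarrow> real) \<Rightarrow> bool" where
  "eigenvalues_of A l \<longleftrightarrow> char_polynomial A = (\<Prod>i\<in>UNIV. [:- l i, 1:])"

(* Polynomials of degree at most two; the leading coefficients may vanish. *)
definition quadratic_polynomial :: "(real ^ 'n::finite \<Rightarrow> real) \<Rightarrow> bool" where
  "quadratic_polynomial f \<longleftrightarrow>
     (\<exists>(a :: 'n \<Rightarrow> 'n \<Rightarrow> real) (b :: 'n \<Rightarrow> real) (c :: real). \<forall>x.
        f x = (\<Sum>i\<in>UNIV. \<Sum>j\<in>UNIV. a i j * x $ i * x $ j) + (\<Sum>i\<in>UNIV. b i * x $ i) + c)"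

end

theory Submission
  imports Defs
begin

text \<open>
  Write \<open>\<Theta> = - u + x \<bullet> Du / 2\<close> for the right-hand side of the equation and \<open>F\<close> for the function
  taking a symmetric matrix to the sum of the arctangents of its eigenvalues, so that
  \<open>\<Theta> = F(D\<^sup>2u)\<close>; these are \<open>shrinker_potential\<close> and \<open>phase\<close> below.  If \<open>u\<close> were smooth,
  differentiating the equation twice would give the elliptic equation
  \<open>g\<^sup>i\<^sup>j \<Theta>\<^sub>i\<^sub>j - x \<bullet> D\<Theta> / 2 = 0\<close> with \<open>g = I + (D\<^sup>2u)\<^sup>2\<close>, which has no zeroth order term.  As
  \<open>\<Theta>\<close> is bounded and \<open>g\<^sup>-\<^sup>1 \<le> I\<close>, the drift term then pins the supremum of \<open>\<Theta>\<close>: for every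
  \<open>\<delta> > 0\<close> there is a function \<open>\<psi>\<close> tending to infinity which is a strict supersolution outside the ball
  of radius \<open>\<delta>\<close>, so \<open>\<Theta>\<close> cannot exceed its values near the origin.  Hence \<open>\<Theta> \<le> \<Theta>(0)\<close>, the
  same argument for \<open>- u\<close> gives equality, and a constant \<open>\<Theta>\<close> makes \<open>u + \<Theta>\<close> positively
  homogeneous of degree two; a function of this kind that is twice differentiable at the origin is a
  quadratic form.

  Since \<open>u\<close> is only \<open>C\<^sup>2\<close>, \<open>\<Theta>\<close> cannot be differentiated twice.  The second derivatives are taken of
  the difference quotient \<open>V(x) = (u(x) - L\<^sup>2 u(x/L)) / (L\<^sup>2 - 1)\<close> instead, where \<open>L > 1\<close> is close to 1.
  By the mean value theorem \<open>V(x) = \<Theta>(x/\<xi>)\<close> for some \<open>\<xi>\<close> between 1 and \<open>L\<close>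
  (\<open>dilation_difference\<close>), so \<open>V\<close> is bounded and close to \<open>\<Theta>\<close> on compact sets.  At a maximum of
  \<open>V - \<epsilon>\<psi>\<close> the Hessians at \<open>x\<close> and at \<open>x/L\<close> are ordered up to a term of size \<open>L\<^sup>2 - 1\<close>, and
  comparing the values of \<open>F\<close> there contradicts the strict supersolution inequality for \<open>\<psi>\<close>, up to
  errors that vanish as \<open>L\<close> tends to 1 (\<open>inequality_at_maximum\<close>, \<open>shrinker_potential_le_origin\<close>).

  The comparison requires that \<open>F\<close> is monotone and has the first order expansion
  \<open>F(B + E) = F(B) + tr((I + B\<^sup>2)\<^sup>-\<^sup>1 E) + O(|E|\<^sup>2)\<close>.  The expansion follows from the scalar one for
  \<open>arctan\<close>, weighted by the doubly stochastic matrix of squared inner products of the two eigenbases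
  (\<open>phase_perturbation\<close>), and monotonicity follows from the expansion by subdividing a segment
  (\<open>phase_mono\<close>); no continuity of eigenvalues is involved.
\<close>

section \<open>Spectral theory of real symmetric matrices\<close>

definition self_adjoint :: "real ^ 'n::finite ^ 'n \<Rightarrow> bool" where
  "self_adjoint A \<longleftrightarrow> (\<forall>x y. (A *v x) \<bullet> y = x \<bullet> (A *v y))"

lemma self_adjointI_entries:
  fixes A :: "real ^ 'n::finite ^ 'n"
  assumes "\<And>i j. A $ i $ j = A $ j $ i"
  shows "self_adjoint A"
proof -
  have "Finite_Cartesian_Product.transpose A = A"
    using assms by (simp add: Finite_Cartesian_Product.transpose_def vec_eq_iff)
  then show ?thesis
    unfolding self_adjoint_def by (metis dot_lmul_matrix transpose_matrix_vector)
qed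

lemma self_adjoint_add: "self_adjoint A \<Longrightarrow> self_adjoint B \<Longrightarrow> self_adjoint (A + B)"
  by (simp add: self_adjoint_def matrix_vector_mult_add_rdistrib inner_add_left inner_add_right)

lemma self_adjoint_scaleR: "self_adjoint A \<Longrightarrow> self_adjoint (c *\<^sub>R A)"
  by (simp add: self_adjoint_def scaleR_matrix_vector_assoc[symmetric])

lemma self_adjoint_diff: "self_adjoint A \<Longrightarrow> self_adjoint B \<Longrightarrow> self_adjoint (A - B)"
  by (simp add: self_adjoint_def matrix_vector_mult_diff_rdistrib inner_diff_left inner_diff_right)

text \<open>
  The induction step of the spectral theorem: the Rayleigh quotient attains its maximum on the unit
  sphere of the orthogonal complement \<open>W\<close> of the eigenvectors found so far, and a maximum point is an
  eigenvector because \<open>W\<close> is invariant.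
\<close>
lemma eigenvector_in_complement:
  fixes A :: "real ^ 'n::finite ^ 'n"
  assumes sa: "self_adjoint A"
    and eig: "\<And>v. v \<in> S \<Longrightarrow> \<exists>\<mu>. A *v v = \<mu> *\<^sub>R v"
    and W: "W = {x. \<forall>v\<in>S. v \<bullet> x = 0}"
    and y: "y \<in> W" "y \<noteq> 0"
  obtains x \<mu> where "x \<in> W" "norm x = 1" "A *v x = \<mu> *\<^sub>R x"
proof -
  have sub: "subspace W"
    unfolding W by (auto simp: subspace_def inner_add_right)
  have "W = (\<Inter>v\<in>S. {x. v \<bullet> x = 0})"
    unfolding W by auto
  then have "closed W"
    by (auto intro!: closed_INT closed_hyperplane)
  then have "compact (sphere 0 1 \<inter> W)"
    by (intro compact_Int_closed compact_sphere)
  moreover have "(1 / norm y) *\<^sub>R y \<in> sphere 0 1 \<inter> W"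
    using y sub by (simp add: subspace_scale)
  moreover have "continuous_on (sphere 0 1 \<inter> W) (\<lambda>x. x \<bullet> (A *v x))"
    by (intro continuous_intros)
  ultimately obtain x where x: "x \<in> sphere 0 1 \<inter> W"
    and xmax: "\<And>z. z \<in> sphere 0 1 \<inter> W \<Longrightarrow> z \<bullet> (A *v z) \<le> x \<bullet> (A *v x)"
    using continuous_attains_sup[of "sphere 0 1 \<inter> W" "\<lambda>x. x \<bullet> (A *v x)"] by blast
  define \<mu> where "\<mu> = x \<bullet> (A *v x)"
  have nx: "x \<bullet> x = 1"
    using x by (simp add: dot_square_norm)
  have rayleigh: "z \<bullet> (A *v z) \<le> \<mu> * (z \<bullet> z)" if "z \<in> W" for z
  proof (cases "z = 0")
    case False
    let ?z = "(1 / norm z) *\<^sub>R z"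
    have "?z \<bullet> (A *v ?z) \<le> \<mu>"
      unfolding \<mu>_def using that sub False by (intro xmax) (simp add: subspace_scale)
    then have "(z \<bullet> (A *v z)) / (norm z)\<^sup>2 \<le> \<mu>"
      by (simp add: matrix_vector_mult_scaleR power2_eq_square)
    then show ?thesis
      using False by (simp add: divide_simps dot_square_norm split: if_splits)
  qed simp
  \<comment> \<open>First variation: the quadratic form is stationary at \<open>x\<close> in every direction of \<open>W\<close> orthogonal to \<open>x\<close>.\<close>
  have stationary: "w \<bullet> (A *v x) = 0" if w: "w \<in> W" "w \<bullet> x = 0" for w
  proof (rule ccontr)
    define c where "c = w \<bullet> (A *v x)"
    define d where "d = \<mu> * (w \<bullet> w) - w \<bullet> (A *v w)"
    assume "w \<bullet> (A *v x) \<noteq> 0"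
    then have c: "c \<noteq> 0" by (simp add: c_def)
    have *: "2 * s * c \<le> s\<^sup>2 * d" for s
    proof -
      have "x + s *\<^sub>R w \<in> W"
        using x w sub by (simp add: subspace_add subspace_scale)
      then have "(x + s *\<^sub>R w) \<bullet> (A *v (x + s *\<^sub>R w)) \<le> \<mu> * ((x + s *\<^sub>R w) \<bullet> (x + s *\<^sub>R w))"
        by (rule rayleigh)
      moreover have "x \<bullet> (A *v w) = c"
        using sa by (metis c_def inner_commute self_adjoint_def)
      then have "(x + s *\<^sub>R w) \<bullet> (A *v (x + s *\<^sub>R w)) = \<mu> + 2 * s * c + s\<^sup>2 * (w \<bullet> (A *v w))"
        by (simp add: matrix_vector_right_distrib matrix_vector_mult_scaleR inner_add_left inner_add_right
            \<mu>_def c_def[symmetric] power2_eq_square algebra_simps)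
      moreover have "(x + s *\<^sub>R w) \<bullet> (x + s *\<^sub>R w) = 1 + s\<^sup>2 * (w \<bullet> w)"
        using w(2) nx by (simp add: inner_add_left inner_add_right inner_commute[of x w] power2_eq_square)
      ultimately have "\<mu> + 2 * s * c + s\<^sup>2 * (w \<bullet> (A *v w)) \<le> \<mu> * (1 + s\<^sup>2 * (w \<bullet> w))"
        by simp
      then show ?thesis by (simp add: d_def algebra_simps)
    qed
    have "d \<ge> 0" using rayleigh[OF w(1)] by (simp add: d_def)
    \<comment> \<open>The inequality is violated for small \<open>s\<close> of the sign of \<open>c\<close>; this choice is small enough for any \<open>d\<close>.\<close>
    have "2 * (c / (1 + d)) * c \<le> (c / (1 + d))\<^sup>2 * d" by (rule *)
    then have "2 * c\<^sup>2 * (1 + d) \<le> c\<^sup>2 * d"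
      using \<open>d \<ge> 0\<close> by (simp add: power2_eq_square divide_simps)
    then have "c\<^sup>2 * (2 + d) \<le> 0"
      by (simp add: algebra_simps)
    moreover have "c\<^sup>2 * (2 + d) > 0"
      using c \<open>d \<ge> 0\<close> by (intro mult_pos_pos) auto
    ultimately show False by linarith
  qed
  define w where "w = A *v x - \<mu> *\<^sub>R x"
  have "w \<in> W"
  proof -
    have "v \<bullet> (A *v x) = 0" if "v \<in> S" for v
    proof -
      from eig[OF that] obtain \<nu> where "A *v v = \<nu> *\<^sub>R v" by (rule exE)
      moreover have "v \<bullet> (A *v x) = (A *v v) \<bullet> x" using sa by (simp add: self_adjoint_def)
      ultimately show ?thesis using x that unfolding W by simp
    qed
    then have "A *v x \<in> W" unfolding W by simp
    then show ?thesis unfolding w_def using x sub by (simp add: subspace_diff subspace_scale)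
  qed
  moreover have wx: "w \<bullet> x = 0"
    using nx by (simp add: w_def \<mu>_def inner_diff_left inner_commute[of "A *v x"])
  ultimately have "w \<bullet> (A *v x) = 0" by (rule stationary)
  then have "w \<bullet> w = 0"
    using wx by (simp add: w_def inner_diff_right)
  then have "A *v x = \<mu> *\<^sub>R x" by (simp add: w_def)
  then show ?thesis using that x by auto
qed

definition eigenbasis :: "real ^ 'n::finite ^ 'n \<Rightarrow> ('n \<Rightarrow> real ^ 'n) \<Rightarrow> ('n \<Rightarrow> real) \<Rightarrow> bool" where
  "eigenbasis A v l \<longleftrightarrow>
     (\<forall>i j. v i \<bullet> v j = (if i = j then 1 else 0)) \<and> (\<forall>i. A *v v i = l i *\<^sub>R v i)"

lemma self_adjoint_eigenbasis:
  fixes A :: "real ^ 'n::finite ^ 'n"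
  assumes sa: "self_adjoint A"
  obtains v l where "eigenbasis A v l"
proof -
  let ?P = "\<lambda>S. finite S \<and> (\<forall>x\<in>S. \<forall>y\<in>S. x \<bullet> y = (if x = y then 1 else 0)) \<and>
              (\<forall>x\<in>S. \<exists>\<mu>. A *v x = \<mu> *\<^sub>R x)"
  have "\<exists>S. ?P S \<and> card S = k" if "k \<le> CARD('n)" for k
    using that
  proof (induction k)
    case 0
    then show ?case by (intro exI[of _ "{}"]) auto
  next
    case (Suc k)
    then obtain S where S: "?P S" "card S = k" by force
    define W where "W = {x. \<forall>v\<in>S. v \<bullet> x = 0}"
    have "dim S \<le> card S" using S by (intro dim_le_card') auto
    then have "dim S < DIM(real ^ 'n)" using S Suc by simp
    then obtain y where y: "y \<noteq> 0" "\<And>z. z \<in> span S \<Longrightarrow> orthogonal y z"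
      using orthogonal_to_subspace_exists by blast
    have yW: "y \<in> W"
      using y(2) span_base by (auto simp: W_def orthogonal_def inner_commute)
    obtain x \<mu> where x: "x \<in> W" "norm x = 1" "A *v x = \<mu> *\<^sub>R x"
      using eigenvector_in_complement[OF sa _ W_def yW y(1)] S(1) by blast
    have xx: "x \<bullet> x = 1" using x(2) by (simp add: dot_square_norm)
    have "x \<notin> S" using x(1) xx unfolding W_def by force
    moreover have "?P (insert x S)"
      using S(1) x(1,3) xx \<open>x \<notin> S\<close> unfolding W_def by (auto simp: inner_commute)
    ultimately show ?case using S by (intro exI[of _ "insert x S"]) auto
  qed
  from this[of "CARD('n)"] obtain S where S: "?P S" "card S = CARD('n)" by blast
  then obtain v where v: "bij_betw v (UNIV :: 'n set) S"
    using finite_same_card_bij[of "UNIV :: 'n set" S] by auto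
  have "\<forall>i. \<exists>\<mu>. A *v v i = \<mu> *\<^sub>R v i"
    using v S(1) by (meson bij_betwE UNIV_I)
  then obtain l where "\<forall>i. A *v v i = l i *\<^sub>R v i" by metis
  moreover have "v i \<bullet> v j = (if i = j then 1 else 0)" for i j
  proof -
    have "v i \<in> S" "v j \<in> S" "v i = v j \<longleftrightarrow> i = j"
      using v by (auto simp: bij_betw_def inj_def)
    then show ?thesis using S(1) by simp
  qed
  ultimately have "eigenbasis A v l" by (simp add: eigenbasis_def)
  then show ?thesis by (rule that)
qed

lemma orthonormal_parseval:
  fixes v :: "'n::finite \<Rightarrow> real ^ 'n"
  assumes "\<And>i j. v i \<bullet> v j = (if i = j then 1 else 0)"
  shows "(\<Sum>i\<in>UNIV. (v i \<bullet> x) * (v i \<bullet> y)) = x \<bullet> y"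
proof -
  define Q :: "real ^ 'n ^ 'n" where "Q = (\<chi> i j. v i $ j)"
  let ?T = "Finite_Cartesian_Product.transpose"
  have "Q ** ?T Q = mat 1"
    using assms by (simp add: Q_def matrix_matrix_mult_def mat_def vec_eq_iff
        Finite_Cartesian_Product.transpose_def inner_vec_def)
  then have Q: "?T Q ** Q = mat 1" by (simp add: matrix_left_right_inverse)
  have Qi: "(Q *v z) $ i = v i \<bullet> z" for z i
    by (simp add: Q_def matrix_vector_mult_def inner_vec_def)
  have "(\<Sum>i\<in>UNIV. (v i \<bullet> x) * (v i \<bullet> y)) = (Q *v x) \<bullet> (Q *v y)"
    by (simp add: inner_vec_def[of "Q *v x"] Qi)
  also have "\<dots> = (?T Q *v (Q *v x)) \<bullet> y"
    by (metis dot_lmul_matrix transpose_matrix_vector transpose_transpose)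
  also have "\<dots> = x \<bullet> y" using Q by (simp add: matrix_vector_mul_assoc)
  finally show ?thesis .
qed

lemma sum_const_poly: "(\<Sum>k\<in>K. [:f k:]) = [:\<Sum>k\<in>K. f k:]"
  by (induction K rule: infinite_finite_induct) auto

lemma sum_singleton_mset: "(\<Sum>i\<in>K. {#k i#}) = image_mset k (mset_set K)"
  by (induction K rule: infinite_finite_induct) auto

text \<open>
  The matrix \<open>x I - A\<close> is conjugated to diagonal form by the orthogonal matrix of eigenvectors, over the
  ring of polynomials, where \<open>det\<close> is still multiplicative.
\<close>
lemma eigenbasis_eigenvalues_of:
  fixes A :: "real ^ 'n::finite ^ 'n"
  assumes "eigenbasis A v l"
  shows "eigenvalues_of A l"
proof -
  let ?T = "Finite_Cartesian_Product.transpose :: real poly ^ 'n ^ 'n \<Rightarrow> real poly ^ 'n ^ 'n"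
  have on: "v i \<bullet> v j = (if i = j then 1 else 0)" and eig: "A *v v i = l i *\<^sub>R v i" for i j
    using assms by (auto simp: eigenbasis_def)
  define Q :: "real poly ^ 'n ^ 'n" where "Q = (\<chi> i j. [:v i $ j:])"
  define M :: "real poly ^ 'n ^ 'n" where
    "M = (\<chi> i j. (if i = j then [:0, 1:] else 0) - [:A $ i $ j:])"
  have const_sum: "(\<Sum>k\<in>UNIV. [:f k:]) = [:(\<Sum>k\<in>UNIV. f k):]" for f :: "'n \<Rightarrow> real"
    by (rule sum_const_poly)
  have "Q ** ?T Q = mat 1"
    using on by (simp add: Q_def matrix_matrix_mult_def mat_def vec_eq_iff const_sum
        Finite_Cartesian_Product.transpose_def inner_vec_def one_pCons)
  then have "det Q * det (?T Q) = 1"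
    by (metis det_I det_mul)
  have MQ: "(M ** ?T Q) $ i $ j = [:- l j, 1:] * [:v j $ i:]" for i j
  proof -
    have "(M ** ?T Q) $ i $ j = (\<Sum>k\<in>UNIV. (if i = k then [:0, 1:] * [:v j $ k:] else 0) - [:A $ i $ k * v j $ k:])"
      unfolding matrix_matrix_mult_def
      by (auto simp: M_def Q_def Finite_Cartesian_Product.transpose_def left_diff_distrib
          mult.commute[of "v j $ _"] intro!: sum.cong)
    also have "\<dots> = [:0, 1:] * [:v j $ i:] - [:(A *v v j) $ i:]"
      by (simp add: sum_subtractf const_sum matrix_vector_mult_def)
    also have "\<dots> = [:- l j, 1:] * [:v j $ i:]"
      by (simp add: eig)
    finally show ?thesis .
  qed
  have "Q ** (M ** ?T Q) = (\<chi> i j. if i = j then [:- l i, 1:] else 0)"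
  proof -
    have "(Q ** (M ** ?T Q)) $ i $ j = (if i = j then [:- l i, 1:] else 0)" for i j
    proof -
      have "(Q ** (M ** ?T Q)) $ i $ j = (\<Sum>k\<in>UNIV. Q $ i $ k * (M ** ?T Q) $ k $ j)"
        by (subst matrix_matrix_mult_def) simp
      also have "\<dots> = (\<Sum>k\<in>UNIV. [:- l j, 1:] * [:v i $ k * v j $ k:])"
        unfolding MQ by (simp add: Q_def mult.commute mult.left_commute)
      also have "\<dots> = [:- l j, 1:] * [:v i \<bullet> v j:]"
        by (simp only: sum_distrib_left[symmetric] const_sum inner_vec_def inner_real_def)
      finally show ?thesis using on by simp
    qed
    then show ?thesis by (simp add: vec_eq_iff)
  qed
  then have "det (Q ** (M ** ?T Q)) = (\<Prod>i\<in>UNIV. [:- l i, 1:])"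
    by (subst det_diagonal) auto
  moreover have "det (Q ** (M ** ?T Q)) = det M"
    using \<open>det Q * det (?T Q) = 1\<close> by (simp add: det_mul algebra_simps)
  ultimately show ?thesis
    by (simp add: eigenvalues_of_def char_polynomial_def M_def)
qed

text \<open>
  A characteristic polynomial determines its roots only as a multiset, which is all that a symmetric
  function of the eigenvalues depends on.
\<close>
lemma eigenvalues_of_sum_cong:
  fixes A :: "real ^ 'n::finite ^ 'n" and f :: "real \<Rightarrow> real"
  assumes "eigenvalues_of A l" "eigenvalues_of A m"
  shows "(\<Sum>i\<in>UNIV. f (l i)) = (\<Sum>i\<in>UNIV. f (m i))"
proof -
  have roots: "proots (\<Prod>i\<in>UNIV. [:- k i, 1:]) = image_mset k (mset_set UNIV)" for k :: "'n \<Rightarrow> real"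
  proof -
    have "proots (\<Prod>i\<in>UNIV. [:- k i, 1:]) = (\<Sum>i\<in>UNIV. {#k i#})"
      by (subst proots_prod) (auto simp: proots_linear_factor)
    also have "\<dots> = image_mset k (mset_set UNIV)"
      by (rule sum_singleton_mset)
    finally show ?thesis .
  qed
  have "image_mset l (mset_set UNIV) = image_mset m (mset_set UNIV)"
    using assms roots by (metis eigenvalues_of_def)
  then have "(\<Sum>x\<in>#image_mset l (mset_set UNIV). f x) = (\<Sum>x\<in>#image_mset m (mset_set UNIV). f x)"
    by simp
  then show ?thesis by (simp add: sum_unfold_sum_mset image_mset.compositionality comp_def)
qed


section \<open>The sum of the arctangents of the eigenvalues\<close>

text \<open>
  For a self-adjoint matrix the chosen family exists and the choice does not matter.
\<close>
definition phase :: "real ^ 'n::finite ^ 'n \<Rightarrow> real" where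
  "phase A = (\<Sum>i\<in>UNIV. arctan ((SOME l. eigenvalues_of A l) i))"

lemma phase_eq:
  assumes "eigenvalues_of A l"
  shows "phase A = (\<Sum>i\<in>UNIV. arctan (l i))"
  unfolding phase_def using someI[of "eigenvalues_of A", OF assms] assms by (rule eigenvalues_of_sum_cong)

text \<open>
  The derivative \<open>1 / (1 + x\<^sup>2)\<close> of \<open>arctan\<close> is 1-Lipschitz, since
  \<open>\<bar>b + x\<bar> \<le> (1 + x\<^sup>2)(1 + b\<^sup>2)\<close>.
\<close>
lemma arctan_first_order:
  "\<bar>arctan a - arctan b - (a - b) / (1 + b\<^sup>2)\<bar> \<le> (a - b)\<^sup>2"
proof -
  obtain x where x: "arctan a - arctan b = (a - b) / (1 + x\<^sup>2)" "\<bar>x - b\<bar> \<le> \<bar>a - b\<bar>"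
  proof (cases a b rule: linorder_cases)
    case less
    obtain z where z: "a < z" "z < b" "arctan b - arctan a = (b - a) * inverse (1 + z\<^sup>2)"
      using MVT2[OF less, of arctan "\<lambda>x. inverse (1 + x\<^sup>2)"] DERIV_arctan by auto
    have "arctan a - arctan b = - ((b - a) * inverse (1 + z\<^sup>2))" using z(3) by linarith
    also have "\<dots> = (a - b) / (1 + z\<^sup>2)"
      by (simp only: divide_inverse mult_minus_left[symmetric] minus_diff_eq)
    finally show ?thesis using z(1,2) by (intro that[of z]) auto
  next
    case greater
    obtain z where "b < z" "z < a" "arctan a - arctan b = (a - b) * inverse (1 + z\<^sup>2)"
      using MVT2[OF greater, of arctan "\<lambda>x. inverse (1 + x\<^sup>2)"] DERIV_arctan by auto
    then show ?thesis by (intro that[of z]) (auto simp: field_simps)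
  qed (auto intro: that[of b])
  have pos: "1 + x\<^sup>2 > 0" "1 + b\<^sup>2 > 0"
    by (simp_all add: add_pos_nonneg)
  have "\<bar>b + x\<bar> \<le> (1 + x\<^sup>2) * (1 + b\<^sup>2)"
  proof -
    have "\<bar>b + x\<bar> \<le> \<bar>b\<bar> + \<bar>x\<bar>" by simp
    also have "\<dots> \<le> 1 + x\<^sup>2 + b\<^sup>2"
      using sum_squares_ge_zero[of "\<bar>b\<bar> - 1/2" "\<bar>x\<bar> - 1/2"]
      by (simp add: power2_eq_square algebra_simps abs_mult_self_eq)
    also have "\<dots> \<le> (1 + x\<^sup>2) * (1 + b\<^sup>2)" by (simp add: algebra_simps)
    finally show ?thesis .
  qed
  then have "\<bar>b + x\<bar> / ((1 + x\<^sup>2) * (1 + b\<^sup>2)) \<le> 1"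
    using pos by simp
  then have "\<bar>a - b\<bar> * \<bar>b - x\<bar> * (\<bar>b + x\<bar> / ((1 + x\<^sup>2) * (1 + b\<^sup>2))) \<le> \<bar>a - b\<bar> * \<bar>b - x\<bar> * 1"
    by (intro mult_left_mono) auto
  also have "\<dots> \<le> \<bar>a - b\<bar> * \<bar>a - b\<bar>"
    using x(2) by (simp add: abs_minus_commute[of b x] mult_left_mono del: abs_mult_self_eq)
  finally have le: "\<bar>a - b\<bar> * \<bar>b - x\<bar> * (\<bar>b + x\<bar> / ((1 + x\<^sup>2) * (1 + b\<^sup>2))) \<le> (a - b)\<^sup>2"
    by (simp add: power2_eq_square)
  have "(a - b) / (1 + x\<^sup>2) - (a - b) / (1 + b\<^sup>2) = (a - b) * (b - x) * ((b + x) / ((1 + x\<^sup>2) * (1 + b\<^sup>2)))"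
    using pos by (simp add: divide_simps) (simp add: algebra_simps power2_eq_square)
  then have "\<bar>(a - b) / (1 + x\<^sup>2) - (a - b) / (1 + b\<^sup>2)\<bar>
      = \<bar>a - b\<bar> * \<bar>b - x\<bar> * (\<bar>b + x\<bar> / ((1 + x\<^sup>2) * (1 + b\<^sup>2)))"
    using pos by (simp add: abs_mult)
  then show ?thesis using le x(1) by simp
qed

text \<open>
  The numbers \<open>c i j = (a i \<bullet> b j)\<^sup>2\<close> formed from the two eigenbases are doubly stochastic, so they turn
  the difference of phases into an average of differences \<open>arctan (\<alpha> i) - arctan (\<beta> j)\<close>.  The
  identity \<open>a i \<bullet> E b j = (\<alpha> i - \<beta> j) (a i \<bullet> b j)\<close> then converts the averages of the first and
  second order terms into expressions in \<open>E\<close> and the basis \<open>b\<close> alone.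
\<close>
lemma phase_perturbation:
  fixes A B :: "real ^ 'n::finite ^ 'n"
  assumes saA: "self_adjoint A" and saE: "self_adjoint E" and A: "A = B + E"
    and b: "eigenbasis B b \<beta>"
  shows "\<bar>phase A - phase B - (\<Sum>j\<in>UNIV. (b j \<bullet> (E *v b j)) / (1 + (\<beta> j)\<^sup>2))\<bar>
           \<le> (\<Sum>j\<in>UNIV. (norm (E *v b j))\<^sup>2)"
proof -
  obtain a \<alpha> where a: "eigenbasis A a \<alpha>"
    using self_adjoint_eigenbasis[OF saA] by blast
  have ona: "a i \<bullet> a j = (if i = j then 1 else 0)" and onb: "b i \<bullet> b j = (if i = j then 1 else 0)"
    and ea: "A *v a i = \<alpha> i *\<^sub>R a i" and eb: "B *v b i = \<beta> i *\<^sub>R b i" for i j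
    using a b by (auto simp: eigenbasis_def)
  define c where "c i j = (a i \<bullet> b j) * (a i \<bullet> b j)" for i j
  have c0: "c i j \<ge> 0" for i j by (simp add: c_def)
  have col: "(\<Sum>i\<in>UNIV. c i j) = 1" for j
    unfolding c_def using orthonormal_parseval[OF ona] onb by simp
  have row: "(\<Sum>j\<in>UNIV. c i j) = 1" for i
    unfolding c_def inner_commute[of "a i"] using orthonormal_parseval[OF onb] ona by simp
  have aE: "a i \<bullet> (E *v b j) = (\<alpha> i - \<beta> j) * (a i \<bullet> b j)" for i j
  proof -
    have "E *v b j = A *v b j - B *v b j" by (simp add: A matrix_vector_mult_add_rdistrib)
    moreover have "a i \<bullet> (A *v b j) = (A *v a i) \<bullet> b j" using saA by (simp add: self_adjoint_def)
    ultimately show ?thesis by (simp only: ea eb inner_diff_right) (simp add: algebra_simps)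
  qed
  have first: "(\<Sum>i\<in>UNIV. c i j * (\<alpha> i - \<beta> j)) = b j \<bullet> (E *v b j)" for j
    using orthonormal_parseval[OF ona, of "E *v b j" "b j"]
    by (simp add: aE c_def inner_commute mult_ac)
  have second: "(\<Sum>i\<in>UNIV. c i j * (\<alpha> i - \<beta> j)\<^sup>2) = (norm (E *v b j))\<^sup>2" for j
    using orthonormal_parseval[OF ona, of "E *v b j" "E *v b j"]
    by (simp add: aE c_def dot_square_norm power2_eq_square mult_ac)
  have "phase A = (\<Sum>i\<in>UNIV. \<Sum>j\<in>UNIV. c i j * arctan (\<alpha> i))"
    by (simp add: phase_eq[OF eigenbasis_eigenvalues_of[OF a]] sum_distrib_right[symmetric] row)
  also have "\<dots> = (\<Sum>j\<in>UNIV. \<Sum>i\<in>UNIV. c i j * arctan (\<alpha> i))"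
    by (rule sum.swap)
  finally have pA: "phase A = (\<Sum>j\<in>UNIV. \<Sum>i\<in>UNIV. c i j * arctan (\<alpha> i))" .
  have pB: "phase B = (\<Sum>j\<in>UNIV. \<Sum>i\<in>UNIV. c i j * arctan (\<beta> j))"
    by (simp add: phase_eq[OF eigenbasis_eigenvalues_of[OF b]] sum_distrib_right[symmetric] col)
  have pE: "(\<Sum>j\<in>UNIV. (b j \<bullet> (E *v b j)) / (1 + (\<beta> j)\<^sup>2)) =
      (\<Sum>j\<in>UNIV. \<Sum>i\<in>UNIV. c i j * ((\<alpha> i - \<beta> j) / (1 + (\<beta> j)\<^sup>2)))"
    by (simp add: first[symmetric] sum_divide_distrib)
  have "phase A - phase B - (\<Sum>j\<in>UNIV. (b j \<bullet> (E *v b j)) / (1 + (\<beta> j)\<^sup>2)) =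
    (\<Sum>j\<in>UNIV. \<Sum>i\<in>UNIV. c i j * (arctan (\<alpha> i) - arctan (\<beta> j) - (\<alpha> i - \<beta> j) / (1 + (\<beta> j)\<^sup>2)))"
    unfolding pA pB pE by (simp add: sum_subtractf[symmetric] right_diff_distrib)
  also have "\<bar>\<dots>\<bar> \<le> (\<Sum>j\<in>UNIV. \<Sum>i\<in>UNIV. c i j * (\<alpha> i - \<beta> j)\<^sup>2)"
    by (intro order.trans[OF sum_abs] sum_mono)
      (simp add: abs_mult c0 mult_left_mono arctan_first_order)
  finally show ?thesis by (simp add: second)
qed

text \<open>
  Going from \<open>A\<close> to \<open>A + Q\<close> in \<open>N\<close> equal steps, the first order term of each step is nonnegative and the
  error is \<open>O(1 / N\<^sup>2)\<close>; the total loss \<open>O(1 / N)\<close> vanishes in the limit.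
\<close>
lemma phase_mono:
  fixes A Q :: "real ^ 'n::finite ^ 'n"
  assumes saA: "self_adjoint A" and saQ: "self_adjoint Q" and pos: "\<And>x. 0 \<le> x \<bullet> (Q *v x)"
  shows "phase A \<le> phase (A + Q)"
proof -
  obtain K where K: "norm (Q *v x) \<le> norm x * K" for x
    using bounded_linear.bounded[OF matrix_vector_mul_bounded_linear[of Q]] by blast
  have step: "phase (A + (m / N) *\<^sub>R Q) - (CARD('n) * K\<^sup>2) / N\<^sup>2 \<le> phase (A + ((m + 1) / N) *\<^sub>R Q)"
    if "N > 0" for m N :: real
  proof -
    define B where "B = A + (m / N) *\<^sub>R Q"
    have saB: "self_adjoint B"
      unfolding B_def by (intro self_adjoint_add self_adjoint_scaleR saA saQ)
    obtain b \<beta> where b: "eigenbasis B b \<beta>" using self_adjoint_eigenbasis[OF saB] by blast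
    then have nb: "norm (b j) = 1" for j by (simp add: eigenbasis_def norm_eq_1)
    have eq: "A + ((m + 1) / N) *\<^sub>R Q = B + (1 / N) *\<^sub>R Q"
      by (simp add: B_def add_divide_distrib scaleR_left_distrib)
    have "0 \<le> (\<Sum>j\<in>UNIV. (b j \<bullet> (((1 / N) *\<^sub>R Q) *v b j)) / (1 + (\<beta> j)\<^sup>2))"
      using \<open>N > 0\<close> pos
      by (intro sum_nonneg divide_nonneg_nonneg) (auto simp: scaleR_matrix_vector_assoc[symmetric])
    moreover have "(\<Sum>j\<in>UNIV. (norm (((1 / N) *\<^sub>R Q) *v b j))\<^sup>2) \<le> (\<Sum>j::'n\<in>UNIV. K\<^sup>2 / N\<^sup>2)"
    proof (intro sum_mono)
      fix j
      have "(norm (Q *v b j))\<^sup>2 \<le> K\<^sup>2"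
        using K[of "b j"] nb by (intro power_mono) auto
      then show "(norm (((1 / N) *\<^sub>R Q) *v b j))\<^sup>2 \<le> K\<^sup>2 / N\<^sup>2"
        using \<open>N > 0\<close>
        by (simp add: scaleR_matrix_vector_assoc[symmetric] power_divide divide_right_mono)
    qed
    ultimately show ?thesis
      using phase_perturbation[OF _ self_adjoint_scaleR[OF saQ] eq b]
        self_adjoint_add[OF saB self_adjoint_scaleR[OF saQ]]
      unfolding eq B_def[symmetric] by (fastforce simp: abs_le_iff)
  qed
  have "phase A - (CARD('n) * K\<^sup>2) / real (Suc N) \<le> phase (A + Q)" for N
  proof -
    have "phase A - m * ((CARD('n) * K\<^sup>2) / (real (Suc N))\<^sup>2) \<le> phase (A + (real m / real (Suc N)) *\<^sub>R Q)" for m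
    proof (induction m)
      case (Suc m)
      then show ?case using step[of "real (Suc N)" "real m"]
        by (simp add: algebra_simps add_divide_distrib)
    qed simp
    from this[of "Suc N"] show ?thesis
      by (simp add: power2_eq_square del: of_nat_Suc)
  qed
  moreover have "(\<lambda>N. phase A - (CARD('n) * K\<^sup>2) / real (Suc N)) \<longlonglongrightarrow> phase A - 0"
    by (intro tendsto_intros LIMSEQ_Suc lim_const_over_n)
  ultimately show ?thesis
    using LIMSEQ_le_const2[of "\<lambda>N. phase A - (CARD('n) * K\<^sup>2) / real (Suc N)"] by auto
qed

text \<open>
  Only \<open>A \<le> B + E\<close> is known in the application: \<open>E\<close> is small of first order while \<open>A - B\<close> need not be,
  which is why monotonicity is combined with the expansion.
\<close>
lemma phase_le_first_order:
  fixes A B E :: "real ^ 'n::finite ^ 'n"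
  assumes sa: "self_adjoint A" "self_adjoint B" "self_adjoint E"
    and le: "\<And>x. x \<bullet> (A *v x) \<le> x \<bullet> (B *v x) + x \<bullet> (E *v x)"
    and b: "eigenbasis B b \<beta>"
  shows "phase A \<le> phase B + (\<Sum>j\<in>UNIV. (b j \<bullet> (E *v b j)) / (1 + (\<beta> j)\<^sup>2))
                     + (\<Sum>j\<in>UNIV. (norm (E *v b j))\<^sup>2)"
proof -
  have "phase A \<le> phase (A + (B + E - A))"
    using le by (intro phase_mono self_adjoint_diff self_adjoint_add sa)
      (simp add: matrix_vector_mult_add_rdistrib matrix_vector_mult_diff_rdistrib
        inner_add_right inner_diff_right)
  also have "A + (B + E - A) = B + E" by simp
  finally show ?thesis
    using phase_perturbation[OF self_adjoint_add[OF sa(2,3)] sa(3) refl b] by linarith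
qed

lemma phase_uminus:
  fixes A :: "real ^ 'n::finite ^ 'n"
  assumes "self_adjoint A"
  shows "phase (- A) = - phase A"
proof -
  obtain a \<alpha> where a: "eigenbasis A a \<alpha>"
    using self_adjoint_eigenbasis[OF assms] by blast
  then have "eigenbasis (- A) a (\<lambda>i. - \<alpha> i)"
    by (simp add: eigenbasis_def matrix_vector_mult_def vec_eq_iff sum_negf)
  with a show ?thesis
    by (simp add: phase_eq[OF eigenbasis_eigenvalues_of] arctan_minus sum_negf)
qed

lemma arctan_bounded_abs: "\<bar>arctan x\<bar> \<le> pi / 2"
  using arctan_bounded[of x] by linarith

lemma abs_phase_le: "\<bar>phase (A :: real ^ 'n::finite ^ 'n)\<bar> \<le> CARD('n) * (pi / 2)"
proof -
  have "\<bar>phase A\<bar> \<le> (\<Sum>i::'n\<in>UNIV. pi / 2)"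
    unfolding phase_def by (intro order.trans[OF sum_abs] sum_mono) (simp only: arctan_bounded_abs)
  then show ?thesis by simp
qed

section \<open>Calculus of twice continuously differentiable functions\<close>

lemma has_derivative_along_line:
  fixes f :: "real ^ 'n::finite \<Rightarrow> real"
  assumes "(f has_derivative D) (at (x + t *\<^sub>R v))"
  shows "((\<lambda>s. f (x + s *\<^sub>R v)) has_real_derivative D v) (at t)"
proof -
  have "((\<lambda>s. x + s *\<^sub>R v) has_derivative (\<lambda>h. h *\<^sub>R v)) (at t)"
    by (auto intro!: derivative_eq_intros)
  then have "((\<lambda>s. f (x + s *\<^sub>R v)) has_derivative (\<lambda>h. D (h *\<^sub>R v))) (at t)"
    using has_derivative_compose[of "\<lambda>s. x + s *\<^sub>R v" _ t UNIV f D] assms by simp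
  moreover have "(\<lambda>h. D (h *\<^sub>R v)) = (*) (D v)"
    using linear_scale[OF has_derivative_linear[OF assms]] by (auto simp: mult.commute)
  ultimately show ?thesis by (simp add: has_field_derivative_def)
qed

lemma C1_line:
  fixes f :: "real ^ 'n::finite \<Rightarrow> real"
  assumes "C1 f"
  shows "((\<lambda>s. f (x + s *\<^sub>R v)) has_real_derivative
            (\<Sum>i\<in>UNIV. v $ i * partial_deriv i f (x + t *\<^sub>R v))) (at t)"
proof -
  let ?y = "x + t *\<^sub>R v"
  obtain D where D: "(f has_derivative D) (at ?y)"
    using assms unfolding C1_def differentiable_def by blast
  have pd: "partial_deriv i f ?y = D (axis i 1)" for i
    unfolding partial_deriv_def
    using has_derivative_along_line[of f D ?y 0 "axis i 1"] D by (simp add: DERIV_imp_deriv)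
  have "D v = D (\<Sum>i\<in>UNIV. v $ i *\<^sub>R axis i 1)"
    using basis_expansion[of v] by (simp add: scalar_mult_eq_scaleR)
  also have "\<dots> = (\<Sum>i\<in>UNIV. v $ i * D (axis i 1))"
    using has_derivative_linear[OF D] by (simp add: linear_sum linear_scale)
  finally have "D v = (\<Sum>i\<in>UNIV. v $ i * partial_deriv i f ?y)" by (simp add: pd)
  then show ?thesis using has_derivative_along_line[OF D] by simp
qed

lemma C1_partial_line:
  fixes f :: "real ^ 'n::finite \<Rightarrow> real"
  assumes "C1 f"
  shows "((\<lambda>s. f (x + s *\<^sub>R axis i 1)) has_real_derivative partial_deriv i f (x + t *\<^sub>R axis i 1)) (at t)"
proof -
  have "(\<Sum>k\<in>UNIV. axis i 1 $ k * partial_deriv k f (x + t *\<^sub>R axis i 1)) = partial_deriv i f (x + t *\<^sub>R axis i 1)"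
    by (subst sum.remove[of _ i]) (auto simp: axis_def intro!: sum.neutral)
  then show ?thesis using C1_line[OF assms, of x "axis i 1" t] by simp
qed

lemma C2_imp_C1: "C2 f \<Longrightarrow> C1 f"
  by (simp add: C2_def)

lemma C1_continuous:
  assumes "C1 f"
  shows "continuous_on S f"
  using assms by (auto simp: C1_def intro!: continuous_at_imp_continuous_on differentiable_imp_continuous_within)

lemma continuous_partial_deriv: "C1 f \<Longrightarrow> continuous_on S (partial_deriv i f)"
  unfolding C1_def using continuous_on_subset by blast

lemma C2_line_second:
  fixes f :: "real ^ 'n::finite \<Rightarrow> real"
  assumes "C2 f"
  shows "((\<lambda>s. \<Sum>j\<in>UNIV. v $ j * partial_deriv j f (x + s *\<^sub>R v)) has_real_derivative
            v \<bullet> (hessian f (x + t *\<^sub>R v) *v v)) (at t)"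
proof -
  have "((\<lambda>s. \<Sum>j\<in>UNIV. v $ j * partial_deriv j f (x + s *\<^sub>R v)) has_real_derivative
      (\<Sum>j\<in>UNIV. v $ j * (\<Sum>i\<in>UNIV. v $ i * partial_deriv i (partial_deriv j f) (x + t *\<^sub>R v)))) (at t)"
    using assms by (intro DERIV_sum DERIV_cmult C1_line) (simp add: C2_def)
  also have "(\<Sum>j\<in>UNIV. v $ j * (\<Sum>i\<in>UNIV. v $ i * partial_deriv i (partial_deriv j f) (x + t *\<^sub>R v)))
      = (\<Sum>i\<in>UNIV. \<Sum>j\<in>UNIV. v $ i * (v $ j * partial_deriv i (partial_deriv j f) (x + t *\<^sub>R v)))"
    by (subst sum.swap) (simp add: sum_distrib_left mult.left_commute)
  also have "\<dots> = v \<bullet> (hessian f (x + t *\<^sub>R v) *v v)"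
    by (simp add: inner_vec_def matrix_vector_mult_def hessian_def sum_distrib_left mult_ac)
  finally show ?thesis .
qed

text \<open>
  The left-hand side is symmetric in \<open>i\<close> and \<open>j\<close>, so letting \<open>h\<close> tend to 0 shows that mixed partial
  derivatives commute.
\<close>
lemma second_difference:
  fixes f :: "real ^ 'n::finite \<Rightarrow> real"
  assumes "C2 f" "0 < h"
  obtains s r where "0 < s" "s < h" "0 < r" "r < h"
    "f (x + h *\<^sub>R axis i 1 + h *\<^sub>R axis j 1) - f (x + h *\<^sub>R axis i 1) - f (x + h *\<^sub>R axis j 1) + f x
       = h\<^sup>2 * partial_deriv j (partial_deriv i f) (x + s *\<^sub>R axis i 1 + r *\<^sub>R axis j 1)"
proof -
  let ?i = "axis i 1 :: real ^ 'n" and ?j = "axis j 1 :: real ^ 'n"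
  have C1: "C1 f" "C1 (partial_deriv i f)" using assms(1) by (simp_all add: C2_def)
  have "((\<lambda>s. f (x + h *\<^sub>R ?j + s *\<^sub>R ?i) - f (x + s *\<^sub>R ?i)) has_real_derivative
      partial_deriv i f (x + h *\<^sub>R ?j + s *\<^sub>R ?i) - partial_deriv i f (x + s *\<^sub>R ?i)) (at s)" for s
    by (intro DERIV_diff C1_partial_line C1)
  from MVT2[OF assms(2) this] obtain s where s: "0 < s" "s < h"
    "f (x + h *\<^sub>R ?j + h *\<^sub>R ?i) - f (x + h *\<^sub>R ?i) - (f (x + h *\<^sub>R ?j) - f x)
      = h * (partial_deriv i f (x + h *\<^sub>R ?j + s *\<^sub>R ?i) - partial_deriv i f (x + s *\<^sub>R ?i))"
    by auto
  have "((\<lambda>r. partial_deriv i f (x + s *\<^sub>R ?i + r *\<^sub>R ?j)) has_real_derivative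
      partial_deriv j (partial_deriv i f) (x + s *\<^sub>R ?i + r *\<^sub>R ?j)) (at r)" for r
    by (intro C1_partial_line C1)
  from MVT2[OF assms(2) this] obtain r where r: "0 < r" "r < h"
    "partial_deriv i f (x + s *\<^sub>R ?i + h *\<^sub>R ?j) - partial_deriv i f (x + s *\<^sub>R ?i)
      = h * partial_deriv j (partial_deriv i f) (x + s *\<^sub>R ?i + r *\<^sub>R ?j)"
    by auto
  have c: "x + h *\<^sub>R ?j + h *\<^sub>R ?i = x + h *\<^sub>R ?i + h *\<^sub>R ?j"
    "x + h *\<^sub>R ?j + s *\<^sub>R ?i = x + s *\<^sub>R ?i + h *\<^sub>R ?j"
    by simp_all
  have "f (x + h *\<^sub>R ?i + h *\<^sub>R ?j) - f (x + h *\<^sub>R ?i) - f (x + h *\<^sub>R ?j) + f x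
       = h * (h * partial_deriv j (partial_deriv i f) (x + s *\<^sub>R ?i + r *\<^sub>R ?j))"
    using s(3) unfolding c r(3) by linarith
  then have "f (x + h *\<^sub>R ?i + h *\<^sub>R ?j) - f (x + h *\<^sub>R ?i) - f (x + h *\<^sub>R ?j) + f x
       = h\<^sup>2 * partial_deriv j (partial_deriv i f) (x + s *\<^sub>R ?i + r *\<^sub>R ?j)"
    by (simp only: power2_eq_square mult.assoc)
  then show ?thesis using that s r by blast
qed

lemma mixed_partials_commute:
  fixes f :: "real ^ 'n::finite \<Rightarrow> real"
  assumes "C2 f"
  shows "partial_deriv i (partial_deriv j f) x = partial_deriv j (partial_deriv i f) x"
proof -
  define g where "g i j = partial_deriv i (partial_deriv j f)" for i j
  have cont: "isCont (g i j) x" for i j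
    using assms unfolding g_def C2_def C1_def by (auto simp: continuous_on_eq_continuous_at)
  have "\<bar>g i j x - g j i x\<bar> \<le> e" if "e > 0" for e
  proof -
    obtain d1 where d1: "d1 > 0" "\<And>y. dist y x < d1 \<Longrightarrow> dist (g i j y) (g i j x) < e / 2"
      using cont[of i j] \<open>e > 0\<close> unfolding continuous_at_eps_delta by (meson half_gt_zero)
    obtain d2 where d2: "d2 > 0" "\<And>y. dist y x < d2 \<Longrightarrow> dist (g j i y) (g j i x) < e / 2"
      using cont[of j i] \<open>e > 0\<close> unfolding continuous_at_eps_delta by (meson half_gt_zero)
    define h where "h = min d1 d2 / 2"
    have h: "h > 0" "2 * h \<le> d1" "2 * h \<le> d2" using d1 d2 by (auto simp: h_def)
    have near: "dist (x + s *\<^sub>R axis k 1 + r *\<^sub>R axis l 1) x < 2 * h"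
      if "0 < s" "s < h" "0 < r" "r < h" for s r :: real and k l :: 'n
    proof -
      have "norm (s *\<^sub>R axis k 1 + r *\<^sub>R axis l 1 :: real ^ 'n) \<le> s + r"
        using that by (intro norm_triangle_le) (simp add: norm_axis_1)
      then show ?thesis using that by (simp add: dist_norm algebra_simps)
    qed
    obtain s r where sr: "0 < s" "s < h" "0 < r" "r < h"
      "f (x + h *\<^sub>R axis i 1 + h *\<^sub>R axis j 1) - f (x + h *\<^sub>R axis i 1) - f (x + h *\<^sub>R axis j 1) + f x
       = h\<^sup>2 * g j i (x + s *\<^sub>R axis i 1 + r *\<^sub>R axis j 1)"
      using second_difference[OF assms h(1), of x i j] unfolding g_def by blast
    obtain s' r' where sr': "0 < s'" "s' < h" "0 < r'" "r' < h"
      "f (x + h *\<^sub>R axis j 1 + h *\<^sub>R axis i 1) - f (x + h *\<^sub>R axis j 1) - f (x + h *\<^sub>R axis i 1) + f x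
       = h\<^sup>2 * g i j (x + s' *\<^sub>R axis j 1 + r' *\<^sub>R axis i 1)"
      using second_difference[OF assms h(1), of x j i] unfolding g_def by blast
    have c: "x + h *\<^sub>R axis j 1 + h *\<^sub>R axis i 1 = x + h *\<^sub>R axis i 1 + h *\<^sub>R axis j (1::real)" by simp
    have "h\<^sup>2 * g j i (x + s *\<^sub>R axis i 1 + r *\<^sub>R axis j 1) = h\<^sup>2 * g i j (x + s' *\<^sub>R axis j 1 + r' *\<^sub>R axis i 1)"
      using sr(5) sr'(5) unfolding c by linarith
    then have "g j i (x + s *\<^sub>R axis i 1 + r *\<^sub>R axis j 1) = g i j (x + s' *\<^sub>R axis j 1 + r' *\<^sub>R axis i 1)"
      using h(1) by simp
    moreover have "dist (g j i (x + s *\<^sub>R axis i 1 + r *\<^sub>R axis j 1)) (g j i x) < e / 2"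
      using near[of s r i j] sr h by (intro d2) auto
    moreover have "dist (g i j (x + s' *\<^sub>R axis j 1 + r' *\<^sub>R axis i 1)) (g i j x) < e / 2"
      using near[of s' r' j i] sr' h by (intro d1) auto
    ultimately show ?thesis unfolding dist_real_def by linarith
  qed
  then have "\<bar>g i j x - g j i x\<bar> \<le> 0" by (rule dense_ge)
  then show ?thesis by (simp add: g_def)
qed

lemma hessian_self_adjoint: "C2 f \<Longrightarrow> self_adjoint (hessian f x)"
  by (rule self_adjointI_entries) (simp add: hessian_def mixed_partials_commute)

lemma continuous_on_hessian:
  fixes f :: "real ^ 'n::finite \<Rightarrow> real"
  assumes "C2 f"
  shows "continuous_on S (hessian f)"
  unfolding hessian_def using assms
  by (intro continuous_on_vec_lambda continuous_partial_deriv) (simp add: C2_def)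

lemma eigenvalue_bound_on_compact:
  fixes f :: "real ^ 'n::finite \<Rightarrow> real"
  assumes "C2 f" "compact S"
  obtains \<Lambda> where "\<And>x v l j. x \<in> S \<Longrightarrow> eigenbasis (hessian f x) v l \<Longrightarrow> \<bar>l j\<bar> \<le> \<Lambda>"
proof -
  have "bounded (hessian f ` S)"
    using assms by (intro compact_imp_bounded compact_continuous_image continuous_on_hessian)
  then obtain \<Lambda> where \<Lambda>: "norm (hessian f x) \<le> \<Lambda>" if "x \<in> S" for x
    unfolding bounded_iff by blast
  have "\<bar>l j\<bar> \<le> \<Lambda>" if "x \<in> S" "eigenbasis (hessian f x) v l" for x v l j
  proof -
    let ?A = "hessian f x"
    have v: "norm (v j) = 1" "?A *v v j = l j *\<^sub>R v j"
      using that(2) by (auto simp: eigenbasis_def norm_eq_1)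
    have "\<bar>(?A *v v j) $ i\<bar> \<le> norm (?A $ i)" for i
      using Cauchy_Schwarz_ineq2[of "?A $ i" "v j"] v(1)
      by (simp add: matrix_vector_mult_def inner_vec_def)
    then have "norm (?A *v v j) \<le> norm ?A"
      unfolding norm_vec_def by (intro L2_set_mono) auto
    then show ?thesis using \<Lambda>[OF that(1)] v by simp
  qed
  then show ?thesis using that by blast
qed

lemma second_derivative_test:
  fixes g :: "real \<Rightarrow> real"
  assumes g: "\<And>t. (g has_real_derivative g' t) (at t)" and g': "(g' has_real_derivative c) (at 0)"
    and max: "\<And>t. g t \<le> g 0"
  shows "g' 0 = 0" "c \<le> 0"
proof -
  show z: "g' 0 = 0" using DERIV_local_max[OF g zero_less_one] max by blast
  show "c \<le> 0"
  proof (rule ccontr)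
    assume "\<not> c \<le> 0"
    then obtain d where d: "d > 0" "\<And>h. 0 < h \<Longrightarrow> h < d \<Longrightarrow> g' 0 < g' (0 + h)"
      using DERIV_pos_inc_right[OF g'] by auto
    obtain s where "0 < s" "s < d / 2" "g (d / 2) - g 0 = (d / 2 - 0) * g' s"
      using MVT2[of 0 "d / 2" g g'] g d(1) by auto
    moreover have "g' s > 0" using d(2)[of s] \<open>0 < s\<close> \<open>s < d / 2\<close> z by simp
    ultimately have "g (d / 2) > g 0" using d(1) by (simp add: algebra_simps) (smt (verit) mult_pos_pos)
    then show False using max[of "d / 2"] by simp
  qed
qed

section \<open>Difference quotients under dilation\<close>

definition shrinker_potential :: "(real ^ 'n::finite \<Rightarrow> real) \<Rightarrow> real ^ 'n \<Rightarrow> real" where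
  "shrinker_potential u x = - u x + 1 / 2 * (\<Sum>i\<in>UNIV. x $ i * partial_deriv i u x)"

text \<open>
  The derivative of \<open>\<mu>\<^sup>2 u(x/\<mu>)\<close> in \<open>\<mu>\<close> is \<open>- 2 \<mu> \<Theta>(x/\<mu>)\<close>; Cauchy's mean value theorem with
  comparison function \<open>\<mu>\<^sup>2\<close> removes the factor \<open>2 \<mu>\<close>.
\<close>
lemma dilation_difference:
  fixes u :: "real ^ 'n::finite \<Rightarrow> real"
  assumes "C1 u" and L: "1 < L"
  obtains \<xi> where "1 < \<xi>" "\<xi> < L"
    "u x - L\<^sup>2 * u ((1 / L) *\<^sub>R x) = (L\<^sup>2 - 1) * shrinker_potential u ((1 / \<xi>) *\<^sub>R x)"
proof -
  let ?G = "\<lambda>\<mu>. \<mu>\<^sup>2 * u ((1 / \<mu>) *\<^sub>R x)"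
  have D: "(?G has_real_derivative - (2 * \<mu> * shrinker_potential u ((1 / \<mu>) *\<^sub>R x))) (at \<mu>)" if "\<mu> > 0" for \<mu>
  proof -
    define S where "S = (\<Sum>i\<in>UNIV. x $ i * partial_deriv i u ((1 / \<mu>) *\<^sub>R x))"
    have "((\<lambda>s. u (0 + s *\<^sub>R x)) has_real_derivative S) (at (1 / \<mu>))"
      unfolding S_def using C1_line[OF assms(1), of 0 x "1 / \<mu>"] by simp
    moreover have "((\<lambda>\<mu>. 1 / \<mu>) has_real_derivative - (1 / \<mu>\<^sup>2)) (at \<mu>)"
      using that by (auto intro!: derivative_eq_intros simp: power2_eq_square)
    ultimately have "((\<lambda>\<mu>. u (0 + (1 / \<mu>) *\<^sub>R x)) has_real_derivative S * - (1 / \<mu>\<^sup>2)) (at \<mu>)"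
      by (rule DERIV_chain2)
    then have *: "((\<lambda>\<mu>. u ((1 / \<mu>) *\<^sub>R x)) has_real_derivative S * - (1 / \<mu>\<^sup>2)) (at \<mu>)" by simp
    have "(?G has_real_derivative (2 * \<mu> * u ((1 / \<mu>) *\<^sub>R x) + (S * - (1 / \<mu>\<^sup>2)) * \<mu>\<^sup>2)) (at \<mu>)"
      by (rule DERIV_mult[OF _ *]) (auto intro!: derivative_eq_intros)
    moreover have "2 * \<mu> * u ((1 / \<mu>) *\<^sub>R x) + (S * - (1 / \<mu>\<^sup>2)) * \<mu>\<^sup>2
        = - (2 * \<mu> * shrinker_potential u ((1 / \<mu>) *\<^sub>R x))"
    proof -
      have "shrinker_potential u ((1 / \<mu>) *\<^sub>R x) = - u ((1 / \<mu>) *\<^sub>R x) + 1 / 2 * (S / \<mu>)"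
        by (simp add: shrinker_potential_def S_def sum_divide_distrib)
      then show ?thesis using that by (simp add: field_simps)
    qed
    ultimately show ?thesis by simp
  qed
  have sq: "((\<lambda>\<mu>. \<mu>\<^sup>2) has_real_derivative 2 * \<mu>) (at \<mu>)" for \<mu> :: real
    by (auto intro!: derivative_eq_intros)
  have "\<exists>c>1. c < L \<and> (?G L - ?G 1) * (2 * c) = (L\<^sup>2 - 1\<^sup>2) * - (2 * c * shrinker_potential u ((1 / c) *\<^sub>R x))"
  proof (rule GMVT'[OF L])
    show "isCont ?G \<mu>" if "1 \<le> \<mu>" "\<mu> \<le> L" for \<mu>
      using that by (intro DERIV_isCont[OF D]) simp
    show "isCont (\<lambda>\<mu>. \<mu>\<^sup>2) \<mu>" for \<mu> :: real
      by (rule DERIV_isCont[OF sq])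
  qed (use D sq in auto)
  then obtain c where c: "c > 1" "c < L"
    "(?G L - ?G 1) * (2 * c) = (L\<^sup>2 - 1\<^sup>2) * - (2 * c * shrinker_potential u ((1 / c) *\<^sub>R x))"
    by blast
  then have "2 * c * (?G L - ?G 1) = 2 * c * - ((L\<^sup>2 - 1) * shrinker_potential u ((1 / c) *\<^sub>R x))"
    by (simp add: algebra_simps)
  then have "?G L - ?G 1 = - ((L\<^sup>2 - 1) * shrinker_potential u ((1 / c) *\<^sub>R x))"
    using c(1) by (subst (asm) mult_cancel_left) auto
  then show ?thesis using that[OF c(1,2)] by simp
qed

text \<open>
  The vector field \<open>G\<close> is the gradient of \<open>\<psi>\<close> and \<open>P\<close> its Hessian at \<open>x\<close>.  The factor of \<open>\<epsilon>\<close>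
  on the right is the operator \<open>g\<^sup>i\<^sup>j \<partial>\<^sub>i\<partial>\<^sub>j - x \<bullet> D / 2\<close> applied to \<open>\<psi>\<close>, with coefficients taken
  at \<open>x/L\<close>.  The second order condition at the maximum bounds the Hessian at \<open>x\<close> by the one at \<open>x/L\<close>,
  hence bounds \<open>\<Theta>(x) - \<Theta>(x/L)\<close> from above; the first order condition in the radial direction
  evaluates the same difference through the definition of \<open>\<Theta>\<close>.
\<close>
lemma inequality_at_maximum:
  fixes u :: "real ^ 'n::finite \<Rightarrow> real"
  assumes u: "C2 u" and eq: "\<And>x. phase (hessian u x) = shrinker_potential u x"
    and L: "1 < L"
    and V: "\<And>x. V x = (u x - L\<^sup>2 * u ((1 / L) *\<^sub>R x)) / (L\<^sup>2 - 1)"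
    and \<psi>1: "\<And>v t. ((\<lambda>s. \<psi> (x + s *\<^sub>R v)) has_real_derivative v \<bullet> G (x + t *\<^sub>R v)) (at t)"
    and \<psi>2: "\<And>v. ((\<lambda>s. v \<bullet> G (x + s *\<^sub>R v)) has_real_derivative v \<bullet> (P *v v)) (at 0)"
    and P: "self_adjoint P"
    and max: "\<And>y. V y - \<epsilon> * \<psi> y \<le> V x - \<epsilon> * \<psi> x"
    and b: "eigenbasis (hessian u ((1 / L) *\<^sub>R x)) b \<beta>"
  shows "shrinker_potential u ((1 / L) *\<^sub>R x) - V x
           \<le> \<epsilon> * ((\<Sum>j\<in>UNIV. (b j \<bullet> (P *v b j)) / (1 + (\<beta> j)\<^sup>2)) - x \<bullet> G x / 2)
             + (L\<^sup>2 - 1) * \<epsilon>\<^sup>2 * (\<Sum>j\<in>UNIV. (norm (P *v b j))\<^sup>2)"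
proof -
  define t where "t = L\<^sup>2 - 1"
  define y where "y = (1 / L) *\<^sub>R x"
  have "t > 0" using L by (simp add: t_def)
  have C1: "C1 u" using u by (rule C2_imp_C1)
  let ?D = "\<lambda>v z. \<Sum>j\<in>UNIV. v $ j * partial_deriv j u z"
  have tests: "(?D v x - L * ?D v y) / t - \<epsilon> * (v \<bullet> G x) = 0"
      "(v \<bullet> (hessian u x *v v) - v \<bullet> (hessian u y *v v)) / t - \<epsilon> * (v \<bullet> (P *v v)) \<le> 0" for v
  proof -
    let ?w = "(1 / L) *\<^sub>R v"
    define g where "g s = (u (x + s *\<^sub>R v) - L\<^sup>2 * u (y + s *\<^sub>R ?w)) / t - \<epsilon> * \<psi> (x + s *\<^sub>R v)" for s
    define g' where "g' s = (?D v (x + s *\<^sub>R v) - L\<^sup>2 * ?D ?w (y + s *\<^sub>R ?w)) / t - \<epsilon> * (v \<bullet> G (x + s *\<^sub>R v))" for s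
    have 1: "(g has_real_derivative g' s) (at s)" for s
      unfolding g_def g'_def
      by (intro DERIV_diff DERIV_cmult DERIV_cdivide C1_line[OF C1] \<psi>1)
    have 2: "(g' has_real_derivative
        (v \<bullet> (hessian u (x + 0 *\<^sub>R v) *v v) - L\<^sup>2 * (?w \<bullet> (hessian u (y + 0 *\<^sub>R ?w) *v ?w))) / t - \<epsilon> * (v \<bullet> (P *v v))) (at 0)"
      unfolding g'_def
      by (intro DERIV_diff DERIV_cmult DERIV_cdivide C2_line_second[OF u] \<psi>2)
    have g: "g s = V (x + s *\<^sub>R v) - \<epsilon> * \<psi> (x + s *\<^sub>R v)" for s
      by (simp add: g_def V t_def y_def scaleR_add_right)
    have 3: "g s \<le> g 0" for s using max[of "x + s *\<^sub>R v"] unfolding g by simp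
    have "g' 0 = 0" by (rule second_derivative_test(1)[OF 1 2 3])
    moreover have "L\<^sup>2 * ?D ?w y = L * ?D v y"
      using L by (simp add: sum_distrib_left power2_eq_square)
    ultimately show "(?D v x - L * ?D v y) / t - \<epsilon> * (v \<bullet> G x) = 0" by (simp add: g'_def)
    show "(v \<bullet> (hessian u x *v v) - v \<bullet> (hessian u y *v v)) / t - \<epsilon> * (v \<bullet> (P *v v)) \<le> 0"
      using second_derivative_test(2)[OF 1 2 3] L
      by (simp add: matrix_vector_mult_scaleR power2_eq_square)
  qed
  define E where "E = (t * \<epsilon>) *\<^sub>R P"
  have "v \<bullet> (hessian u x *v v) \<le> v \<bullet> (hessian u y *v v) + v \<bullet> (E *v v)" for v
    using tests(2)[of v] \<open>t > 0\<close>
    by (simp add: E_def scaleR_matrix_vector_assoc[symmetric] field_simps)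
  from phase_le_first_order[OF hessian_self_adjoint[OF u] hessian_self_adjoint[OF u] _ this b[folded y_def]]
  have "shrinker_potential u x \<le> shrinker_potential u y
      + (\<Sum>j\<in>UNIV. (b j \<bullet> (E *v b j)) / (1 + (\<beta> j)\<^sup>2)) + (\<Sum>j\<in>UNIV. (norm (E *v b j))\<^sup>2)"
    unfolding eq E_def using P self_adjoint_scaleR by blast
  also have "(\<Sum>j\<in>UNIV. (b j \<bullet> (E *v b j)) / (1 + (\<beta> j)\<^sup>2)) = t * (\<epsilon> * (\<Sum>j\<in>UNIV. (b j \<bullet> (P *v b j)) / (1 + (\<beta> j)\<^sup>2)))"
    by (simp add: E_def scaleR_matrix_vector_assoc[symmetric] sum_distrib_left mult.assoc)
  also have "(\<Sum>j\<in>UNIV. (norm (E *v b j))\<^sup>2) = t * (t * \<epsilon>\<^sup>2 * (\<Sum>j\<in>UNIV. (norm (P *v b j))\<^sup>2))"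
  proof -
    have "(norm (E *v b j))\<^sup>2 = t * (t * \<epsilon>\<^sup>2 * (norm (P *v b j))\<^sup>2)" for j
      by (simp add: E_def scaleR_matrix_vector_assoc[symmetric] power_mult_distrib) (simp add: power2_eq_square)
    then show ?thesis by (simp add: sum_distrib_left)
  qed
  finally have main: "shrinker_potential u x \<le> shrinker_potential u y
      + t * (\<epsilon> * (\<Sum>j\<in>UNIV. (b j \<bullet> (P *v b j)) / (1 + (\<beta> j)\<^sup>2)))
      + t * (t * \<epsilon>\<^sup>2 * (\<Sum>j\<in>UNIV. (norm (P *v b j))\<^sup>2))" .
  have "?D x x = L * ?D x y + t * (\<epsilon> * (x \<bullet> G x))"
    using tests(1)[of x] \<open>t > 0\<close> by (simp add: field_simps)
  moreover have "u x = L\<^sup>2 * u y + t * V x"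
    using \<open>t > 0\<close> by (simp add: V t_def[symmetric] y_def)
  moreover have "L\<^sup>2 * shrinker_potential u y = - L\<^sup>2 * u y + 1 / 2 * (L * ?D x y)"
  proof -
    have "?D y y = ?D x y / L" by (simp add: y_def sum_divide_distrib)
    then show ?thesis using L by (simp add: shrinker_potential_def field_simps power2_eq_square)
  qed
  ultimately have "shrinker_potential u x = L\<^sup>2 * shrinker_potential u y + t * (- V x + \<epsilon> * (x \<bullet> G x) / 2)"
    by (simp add: shrinker_potential_def[of u x] algebra_simps)
  then have "shrinker_potential u x = shrinker_potential u y + t * (shrinker_potential u y - V x + \<epsilon> * (x \<bullet> G x) / 2)"
    by (simp add: t_def algebra_simps)
  with main have "t * (shrinker_potential u y - V x + \<epsilon> * (x \<bullet> G x) / 2) \<le>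
     t * (\<epsilon> * (\<Sum>j\<in>UNIV. (b j \<bullet> (P *v b j)) / (1 + (\<beta> j)\<^sup>2)) + t * \<epsilon>\<^sup>2 * (\<Sum>j\<in>UNIV. (norm (P *v b j))\<^sup>2))"
    by (simp add: distrib_left)
  then have "shrinker_potential u y - V x + \<epsilon> * (x \<bullet> G x) / 2 \<le>
     \<epsilon> * (\<Sum>j\<in>UNIV. (b j \<bullet> (P *v b j)) / (1 + (\<beta> j)\<^sup>2)) + t * \<epsilon>\<^sup>2 * (\<Sum>j\<in>UNIV. (norm (P *v b j))\<^sup>2)"
    using \<open>t > 0\<close> by (simp only: mult_le_cancel_left_pos)
  then show ?thesis by (simp add: t_def y_def right_diff_distrib)
qed

section \<open>The barrier\<close>

text \<open>
  The bounded part is a concave increasing function of \<open>|x|\<^sup>2\<close>, whose negative second derivative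
  produces strict inequality on compact sets away from the origin; the small multiple \<open>\<eta>\<close> of
  \<open>|x|\<^sup>2\<close> makes the barrier tend to infinity.
\<close>
definition barrier :: "real \<Rightarrow> real \<Rightarrow> real ^ 'n::finite \<Rightarrow> real" where
  "barrier K \<eta> x = (1 - exp (- K * (x \<bullet> x))) / K + \<eta> * (x \<bullet> x)"

definition barrier_grad :: "real \<Rightarrow> real \<Rightarrow> real ^ 'n::finite \<Rightarrow> real ^ 'n" where
  "barrier_grad K \<eta> x = (2 * (exp (- K * (x \<bullet> x)) + \<eta>)) *\<^sub>R x"

definition barrier_hess :: "real \<Rightarrow> real \<Rightarrow> real ^ 'n::finite \<Rightarrow> real ^ 'n ^ 'n" where
  "barrier_hess K \<eta> x = (2 * (exp (- K * (x \<bullet> x)) + \<eta>)) *\<^sub>R mat 1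
      - (4 * K * exp (- K * (x \<bullet> x))) *\<^sub>R (\<chi> i j. x $ i * x $ j)"

lemma barrier_hess_mult:
  "barrier_hess K \<eta> x *v v = (2 * (exp (- K * (x \<bullet> x)) + \<eta>)) *\<^sub>R v
     - (4 * K * exp (- K * (x \<bullet> x)) * (x \<bullet> v)) *\<^sub>R x"
proof -
  have "(\<chi> i j. x $ i * x $ j) *v v = (x \<bullet> v) *\<^sub>R x"
    by (simp add: matrix_vector_mult_def vec_eq_iff inner_vec_def sum_distrib_left sum_distrib_right mult_ac)
  then show ?thesis
    by (simp add: barrier_hess_def matrix_vector_mult_diff_rdistrib scaleR_matrix_vector_assoc[symmetric])
qed

lemma barrier_hess_self_adjoint: "self_adjoint (barrier_hess K \<eta> x)"
  by (simp add: self_adjoint_def barrier_hess_mult inner_diff_left inner_diff_right inner_commute)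

lemma norm_square_line:
  fixes x v :: "real ^ 'n::finite"
  shows "((\<lambda>s. (x + s *\<^sub>R v) \<bullet> (x + s *\<^sub>R v)) has_real_derivative 2 * (v \<bullet> (x + t *\<^sub>R v))) (at t)"
proof -
  have "((\<lambda>s. x \<bullet> x + 2 * s * (x \<bullet> v) + s\<^sup>2 * (v \<bullet> v)) has_real_derivative 2 * (v \<bullet> (x + t *\<^sub>R v))) (at t)"
    by (auto intro!: derivative_eq_intros simp: inner_add_right inner_commute algebra_simps)
  moreover have "(\<lambda>s. (x + s *\<^sub>R v) \<bullet> (x + s *\<^sub>R v)) = (\<lambda>s. x \<bullet> x + 2 * s * (x \<bullet> v) + s\<^sup>2 * (v \<bullet> v))"
    by (auto simp: inner_add_left inner_add_right inner_commute[of v x] power2_eq_square algebra_simps)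
  ultimately show ?thesis by simp
qed

lemma barrier_line:
  fixes x v :: "real ^ 'n::finite"
  assumes "K \<noteq> 0"
  shows "((\<lambda>s. barrier K \<eta> (x + s *\<^sub>R v)) has_real_derivative v \<bullet> barrier_grad K \<eta> (x + t *\<^sub>R v)) (at t)"
  unfolding barrier_def barrier_grad_def
  by (rule derivative_eq_intros norm_square_line refl assms)+
    (use assms in \<open>simp only: inner_scaleR_right, simp add: divide_simps, simp add: algebra_simps\<close>)

lemma barrier_grad_line:
  fixes x v :: "real ^ 'n::finite"
  shows "((\<lambda>s. v \<bullet> barrier_grad K \<eta> (x + s *\<^sub>R v)) has_real_derivative v \<bullet> (barrier_hess K \<eta> x *v v)) (at 0)"
proof -
  have "((\<lambda>s. v \<bullet> (x + s *\<^sub>R v)) has_real_derivative v \<bullet> v) (at 0)"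
    by (auto simp: inner_add_right intro!: derivative_eq_intros)
  moreover have "((\<lambda>s. 2 * (exp (- K * ((x + s *\<^sub>R v) \<bullet> (x + s *\<^sub>R v))) + \<eta>)) has_real_derivative
      2 * (exp (- K * (x \<bullet> x)) * (- K * (2 * (v \<bullet> x))))) (at 0)"
    by (rule derivative_eq_intros norm_square_line refl)+ simp
  ultimately have "((\<lambda>s. 2 * (exp (- K * ((x + s *\<^sub>R v) \<bullet> (x + s *\<^sub>R v))) + \<eta>) * (v \<bullet> (x + s *\<^sub>R v)))
     has_real_derivative 2 * (exp (- K * (x \<bullet> x)) * (- K * (2 * (v \<bullet> x)))) * (v \<bullet> x)
       + (v \<bullet> v) * (2 * (exp (- K * (x \<bullet> x)) + \<eta>))) (at 0)"
    using DERIV_mult by fastforce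
  then show ?thesis
    by (simp add: barrier_grad_def barrier_hess_mult inner_diff_right inner_commute algebra_simps)
qed

lemma barrier_lower:
  assumes "K > 0"
  shows "\<eta> * (x \<bullet> x) \<le> barrier K \<eta> x"
  using assms by (simp add: barrier_def)

lemma norm_barrier_hess_le:
  assumes "K > 0" "\<eta> > 0" "norm x \<le> R"
  shows "norm (barrier_hess K \<eta> x *v v) \<le> (2 * (1 + \<eta>) + 4 * K * R\<^sup>2) * norm v"
proof -
  define e where "e = exp (- K * (x \<bullet> x))"
  have e: "0 \<le> e" "e \<le> 1" using assms by (simp_all add: e_def)
  have "norm (barrier_hess K \<eta> x *v v) \<le> 2 * (e + \<eta>) * norm v + 4 * K * e * \<bar>x \<bullet> v\<bar> * norm x"
    unfolding barrier_hess_mult e_def[symmetric]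
    using e assms by (intro order.trans[OF norm_triangle_ineq4]) (simp add: abs_mult)
  also have "\<dots> \<le> 2 * (1 + \<eta>) * norm v + 4 * K * 1 * (norm x * norm v) * norm x"
    using e assms by (intro add_mono mult_mono mult_right_mono mult_left_mono Cauchy_Schwarz_ineq2) auto
  also have "4 * K * 1 * (norm x * norm v) * norm x = 4 * K * (norm x)\<^sup>2 * norm v"
    by (simp add: power2_eq_square)
  also have "\<dots> \<le> 4 * K * R\<^sup>2 * norm v"
    using assms by (intro mult_right_mono mult_left_mono power_mono) auto
  finally show ?thesis by (simp add: algebra_simps)
qed

text \<open>
  With \<open>s = |x|\<^sup>2\<close> and \<open>e = exp (- K s)\<close>, the trace term is at most \<open>2 n (e + \<eta>)\<close> and the drift
  contributes \<open>- (e + \<eta>) s\<close>, which suffices for \<open>s > 2 n + 1\<close>.  For smaller \<open>s\<close> the eigenvalues are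
  bounded by \<open>\<Lambda>\<close>, and \<open>K\<close> is so large that the concave part contributes at most
  \<open>- 2 (n + 1) e\<close>; there \<open>\<eta>\<close> is small compared with \<open>e\<close>.
\<close>
lemma barrier_strict_supersolution:
  fixes x :: "real ^ 'n::finite" and b :: "'n \<Rightarrow> real ^ 'n" and K \<eta> \<Lambda> :: real
  assumes "K > 0" "\<eta> > 0"
    and \<eta>: "\<eta> * (2 * real CARD('n) + 1) \<le> exp (- K * (2 * real CARD('n) + 1))"
    and on: "\<And>i j. b i \<bullet> b j = (if i = j then 1 else 0)"
    and near: "x \<bullet> x \<le> 2 * real CARD('n) + 1 \<Longrightarrow>
        (\<forall>j. \<bar>\<beta> j\<bar> \<le> \<Lambda>) \<and> (real CARD('n) + 1) * (1 + \<Lambda>\<^sup>2) \<le> 2 * K * (x \<bullet> x)"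
  shows "(\<Sum>j\<in>UNIV. (b j \<bullet> (barrier_hess K \<eta> x *v b j)) / (1 + (\<beta> j)\<^sup>2)) - x \<bullet> barrier_grad K \<eta> x / 2 \<le> - \<eta>"
proof -
  define e where "e = exp (- K * (x \<bullet> x))"
  define n where "n = real CARD('n)"
  define s where "s = x \<bullet> x"
  have "e > 0" by (simp add: e_def)
  have "n > 0" by (simp add: n_def)
  define T where "T = (\<Sum>j\<in>UNIV. (b j \<bullet> x)\<^sup>2 / (1 + (\<beta> j)\<^sup>2))"
  have pos: "1 + (\<beta> j)\<^sup>2 \<ge> 1" for j by simp
  have "T \<ge> 0" unfolding T_def using pos by (intro sum_nonneg divide_nonneg_nonneg) auto
  have quad: "b j \<bullet> (barrier_hess K \<eta> x *v b j) = 2 * (e + \<eta>) - 4 * K * e * (b j \<bullet> x)\<^sup>2" for j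
    unfolding barrier_hess_mult e_def[symmetric]
    by (simp add: inner_diff_right on inner_commute[of x "b j"] power2_eq_square)
  have "(\<Sum>j\<in>UNIV. (b j \<bullet> (barrier_hess K \<eta> x *v b j)) / (1 + (\<beta> j)\<^sup>2))
      = (\<Sum>j\<in>UNIV. 2 * (e + \<eta>) / (1 + (\<beta> j)\<^sup>2) - 4 * K * e * ((b j \<bullet> x)\<^sup>2 / (1 + (\<beta> j)\<^sup>2)))"
    by (simp add: quad diff_divide_distrib)
  also have "\<dots> = (\<Sum>j\<in>UNIV. 2 * (e + \<eta>) / (1 + (\<beta> j)\<^sup>2)) - 4 * K * e * T"
    by (simp only: T_def sum_subtractf sum_distrib_left)
  also have "(\<Sum>j\<in>UNIV. 2 * (e + \<eta>) / (1 + (\<beta> j)\<^sup>2)) \<le> (\<Sum>j::'n\<in>UNIV. 2 * (e + \<eta>))"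
  proof (intro sum_mono)
    fix j :: 'n
    show "2 * (e + \<eta>) / (1 + (\<beta> j)\<^sup>2) \<le> 2 * (e + \<eta>)"
      using divide_left_mono[OF pos[of j], of "2 * (e + \<eta>)"] \<open>e > 0\<close> assms(2) pos[of j] by simp
  qed
  finally have sum: "(\<Sum>j\<in>UNIV. (b j \<bullet> (barrier_hess K \<eta> x *v b j)) / (1 + (\<beta> j)\<^sup>2))
      \<le> 2 * n * (e + \<eta>) - 4 * K * e * T"
    by (simp add: n_def algebra_simps)
  have drift: "x \<bullet> barrier_grad K \<eta> x / 2 = (e + \<eta>) * s"
    by (simp add: barrier_grad_def e_def s_def)
  show ?thesis
  proof (cases "s \<le> 2 * n + 1")
    case True
    then have \<Lambda>: "\<bar>\<beta> j\<bar> \<le> \<Lambda>" and K: "(n + 1) * (1 + \<Lambda>\<^sup>2) \<le> 2 * K * s" for j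
      using near by (auto simp: n_def s_def)
    have "(\<Sum>j\<in>UNIV. (b j \<bullet> x)\<^sup>2 / (1 + \<Lambda>\<^sup>2)) \<le> T"
      unfolding T_def
    proof (intro sum_mono divide_left_mono)
      fix j
      show "1 + (\<beta> j)\<^sup>2 \<le> 1 + \<Lambda>\<^sup>2" using \<Lambda>[of j] abs_le_square_iff[of "\<beta> j" \<Lambda>] by simp
    qed (auto simp: add_pos_nonneg)
    moreover have "(\<Sum>j\<in>UNIV. (b j \<bullet> x)\<^sup>2 / (1 + \<Lambda>\<^sup>2)) = s / (1 + \<Lambda>\<^sup>2)"
      using orthonormal_parseval[OF on, of x x]
      by (simp add: sum_divide_distrib[symmetric] s_def power2_eq_square)
    ultimately have "s / (1 + \<Lambda>\<^sup>2) \<le> T" by simp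
    then have "s \<le> T * (1 + \<Lambda>\<^sup>2)" by (simp add: divide_le_eq add_pos_nonneg)
    then have "2 * K * s \<le> 2 * K * (T * (1 + \<Lambda>\<^sup>2))" using \<open>K > 0\<close> by (intro mult_left_mono) auto
    with K have "(n + 1) * (1 + \<Lambda>\<^sup>2) \<le> (2 * K * T) * (1 + \<Lambda>\<^sup>2)" by simp
    then have "n + 1 \<le> 2 * K * T" by (rule mult_right_le_imp_le) (simp add: add_pos_nonneg)
    then have "2 * e * (n + 1) \<le> 2 * e * (2 * K * T)" using \<open>e > 0\<close> by (intro mult_left_mono) auto
    then have a: "2 * e * n + 2 * e \<le> 4 * K * e * T" by (simp add: algebra_simps)
    have "exp (- K * (2 * n + 1)) \<le> e"
      using True \<open>K > 0\<close> by (simp add: e_def s_def)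
    with \<eta> have b: "2 * (\<eta> * n) + \<eta> \<le> e" by (simp add: n_def algebra_simps)
    have "0 \<le> (e + \<eta>) * s" using \<open>e > 0\<close> \<open>\<eta> > 0\<close> by (simp add: s_def)
    moreover have "2 * n * (e + \<eta>) = 2 * e * n + 2 * (\<eta> * n)" by (simp add: algebra_simps)
    ultimately show ?thesis using sum a b \<open>e > 0\<close> unfolding drift by linarith
  next
    case False
    then have "(e + \<eta>) * (2 * n + 1) \<le> (e + \<eta>) * s"
      using \<open>e > 0\<close> \<open>\<eta> > 0\<close> by (intro mult_left_mono) auto
    moreover have "(e + \<eta>) * (2 * n + 1) = 2 * n * (e + \<eta>) + e + \<eta>" by (simp add: algebra_simps)
    moreover have "0 \<le> 4 * K * e * T" using \<open>K > 0\<close> \<open>e > 0\<close> \<open>T \<ge> 0\<close> by simp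
    ultimately show ?thesis using sum \<open>e > 0\<close> unfolding drift by linarith
  qed
qed

section \<open>The maximum principle and its consequences\<close>

lemma continuous_shrinker_potential:
  fixes u :: "real ^ 'n::finite \<Rightarrow> real"
  assumes "C1 u"
  shows "continuous_on S (shrinker_potential u)"
  unfolding shrinker_potential_def using assms
  by (intro continuous_intros C1_continuous continuous_partial_deriv)

text \<open>
  If \<open>\<Theta>(z) = \<Theta>(0) + 4 \<gamma>\<close> with \<open>\<gamma> > 0\<close>, the constants are chosen in the order
  \<open>\<delta>, \<Lambda>, K, \<eta>, \<epsilon>, R, L\<close>: near the origin \<open>\<Theta>\<close> is at most \<open>\<Theta>(0) + \<gamma>\<close>, while \<open>V - \<epsilon>\<psi>\<close> is at
  least \<open>\<Theta>(0) + 2 \<gamma>\<close> at \<open>z\<close> and at most \<open>\<Theta>(0)\<close> outside the ball of radius \<open>R\<close>.  A maximum point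
  therefore exists and has norm between \<open>\<delta>\<close> and \<open>R\<close>, where the barrier is a strict supersolution and
  where \<open>L\<close> close to 1 makes all errors smaller than the gain \<open>\<epsilon> \<eta>\<close>.
\<close>
lemma shrinker_potential_le_origin:
  fixes u :: "real ^ 'n::finite \<Rightarrow> real"
  assumes u: "C2 u" and eq: "\<And>x. phase (hessian u x) = shrinker_potential u x"
  shows "shrinker_potential u z \<le> shrinker_potential u 0"
proof (rule ccontr)
  let ?\<Theta> = "shrinker_potential u"
  let ?n = "real CARD('n)"
  have C1: "C1 u" using u by (rule C2_imp_C1)
  have cont: "continuous_on S ?\<Theta>" for S using C1 by (rule continuous_shrinker_potential)
  assume "\<not> ?\<Theta> z \<le> ?\<Theta> 0"
  define \<gamma> where "\<gamma> = (?\<Theta> z - ?\<Theta> 0) / 4"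
  have "\<gamma> > 0" using \<open>\<not> ?\<Theta> z \<le> ?\<Theta> 0\<close> by (simp add: \<gamma>_def)
  obtain \<delta> where \<delta>: "\<delta> > 0" "\<And>x. norm x \<le> \<delta> \<Longrightarrow> ?\<Theta> x \<le> ?\<Theta> 0 + \<gamma>"
  proof -
    have "isCont ?\<Theta> 0" using cont[of UNIV] by (simp add: continuous_on_eq_continuous_at)
    then obtain d where "d > 0" and d: "\<And>x. dist x 0 < d \<Longrightarrow> dist (?\<Theta> x) (?\<Theta> 0) < \<gamma>"
      using \<open>\<gamma> > 0\<close> unfolding continuous_at_eps_delta by meson
    have "?\<Theta> x \<le> ?\<Theta> 0 + \<gamma>" if "norm x \<le> d / 2" for x
      using d[of x] that \<open>d > 0\<close> by (simp add: dist_real_def)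
    then show ?thesis using that[of "d / 2"] \<open>d > 0\<close> by simp
  qed
  obtain \<Lambda> where \<Lambda>: "\<And>x v l j. x \<in> cball 0 (sqrt (2 * ?n + 1)) \<Longrightarrow> eigenbasis (hessian u x) v l \<Longrightarrow> \<bar>l j\<bar> \<le> \<Lambda>"
    using eigenvalue_bound_on_compact[OF u compact_cball] by blast
  define K where "K = (?n + 1) * (1 + \<Lambda>\<^sup>2) / (2 * \<delta>\<^sup>2)"
  define \<eta> where "\<eta> = exp (- K * (2 * ?n + 1)) / (2 * ?n + 1)"
  have "K > 0" using \<delta>(1) by (simp add: K_def add_pos_nonneg)
  have "\<eta> > 0" by (simp add: \<eta>_def)
  define \<psi> :: "real ^ 'n \<Rightarrow> real" where "\<psi> = barrier K \<eta>"
  have \<psi>_lower: "\<eta> * (x \<bullet> x) \<le> \<psi> x" for x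
    unfolding \<psi>_def by (rule barrier_lower[OF \<open>K > 0\<close>])
  have \<psi>_nonneg: "0 \<le> \<psi> x" for x
    using \<psi>_lower[of x] \<open>\<eta> > 0\<close> by (meson inner_ge_zero less_imp_le mult_nonneg_nonneg order_trans)
  define \<epsilon> where "\<epsilon> = \<gamma> / (1 + \<psi> z)"
  have "\<epsilon> > 0" using \<open>\<gamma> > 0\<close> \<psi>_nonneg[of z] by (simp add: \<epsilon>_def)
  have \<epsilon>z: "\<epsilon> * \<psi> z \<le> \<gamma>"
    using \<open>\<gamma> > 0\<close> \<psi>_nonneg[of z] by (simp add: \<epsilon>_def divide_le_eq algebra_simps)
  define M where "M = ?n * (pi / 2)"
  have M: "\<bar>?\<Theta> x\<bar> \<le> M" for x using abs_phase_le[of "hessian u x"] by (simp add: eq M_def)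
  define R where "R = sqrt ((M + \<bar>?\<Theta> 0\<bar>) / (\<epsilon> * \<eta>)) + norm z"
  have "M \<ge> 0" by (simp add: M_def)
  have "R \<ge> 0" "norm z \<le> R" using \<open>M \<ge> 0\<close> \<open>\<epsilon> > 0\<close> \<open>\<eta> > 0\<close> by (auto simp: R_def)
  define C where "C = ?n * (2 * (1 + \<eta>) + 4 * K * R\<^sup>2)\<^sup>2"
  have "C \<ge> 0" by (simp add: C_def)
  define \<kappa> where "\<kappa> = min \<gamma> (\<epsilon> * \<eta> / 2)"
  have "\<kappa> > 0" using \<open>\<gamma> > 0\<close> \<open>\<epsilon> > 0\<close> \<open>\<eta> > 0\<close> by (simp add: \<kappa>_def)
  obtain d where "d > 0" and d: "\<And>x y. x \<in> cball 0 R \<Longrightarrow> y \<in> cball 0 R \<Longrightarrow> dist x y < d \<Longrightarrow> dist (?\<Theta> x) (?\<Theta> y) < \<kappa>"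
    using compact_uniformly_continuous[OF cont compact_cball, of 0 R] \<open>\<kappa> > 0\<close>
    unfolding uniformly_continuous_on_def by metis
  \<comment> \<open>The second bound controls the displacement of points of the ball under dilation by factors up to
    \<open>L = 1 + \<tau>\<close>, the third the quadratic error \<open>(L\<^sup>2 - 1) \<epsilon>\<^sup>2 C\<close>.\<close>
  define \<tau> where "\<tau> = min 1 (min (d / (R + 1)) (\<eta> / (12 * \<epsilon> * C + 1)))"
  define L where "L = 1 + \<tau>"
  have "12 * \<epsilon> * C + 1 > 0" using \<open>\<epsilon> > 0\<close> \<open>C \<ge> 0\<close> by (simp add: add_nonneg_pos)
  then have "\<tau> > 0" using \<open>d > 0\<close> \<open>R \<ge> 0\<close> \<open>\<eta> > 0\<close> by (simp add: \<tau>_def)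
  then have "L > 1" by (simp add: L_def)
  then have "L\<^sup>2 > 1" by (simp add: one_less_power)
  have "\<tau> \<le> 1" by (simp add: \<tau>_def)
  have \<tau>R: "\<tau> * R < d"
  proof -
    have "\<tau> \<le> d / (R + 1)" by (simp add: \<tau>_def)
    then have "\<tau> * (R + 1) \<le> d" using \<open>R \<ge> 0\<close> by (simp add: le_divide_eq)
    then show ?thesis using \<open>\<tau> > 0\<close> by (simp add: distrib_left)
  qed
  have small: "(L\<^sup>2 - 1) * \<epsilon>\<^sup>2 * C \<le> \<epsilon> * \<eta> / 2"
  proof -
    have "\<tau> * (12 * \<epsilon> * C + 1) \<le> \<eta>"
      using \<open>12 * \<epsilon> * C + 1 > 0\<close> by (simp add: \<tau>_def pos_le_divide_eq[symmetric])
    then have a: "3 * \<tau> * (\<epsilon> * C) \<le> \<eta> / 4" using \<open>\<tau> > 0\<close> by (simp add: algebra_simps)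
    have "L\<^sup>2 - 1 \<le> 3 * \<tau>"
      using \<open>\<tau> \<le> 1\<close> \<open>\<tau> > 0\<close> by (simp add: L_def power2_eq_square algebra_simps mult_left_le)
    then have "(L\<^sup>2 - 1) * (\<epsilon> * C) \<le> 3 * \<tau> * (\<epsilon> * C)"
      using \<open>\<epsilon> > 0\<close> \<open>C \<ge> 0\<close> by (intro mult_right_mono) auto
    also note a
    finally have "\<epsilon> * ((L\<^sup>2 - 1) * (\<epsilon> * C)) \<le> \<epsilon> * (\<eta> / 4)"
      using \<open>\<epsilon> > 0\<close> by (intro mult_left_mono) auto
    moreover have "\<epsilon> * (\<eta> / 4) \<le> \<epsilon> * \<eta> / 2" using \<open>\<epsilon> > 0\<close> \<open>\<eta> > 0\<close> by simp
    moreover have "(L\<^sup>2 - 1) * \<epsilon>\<^sup>2 * C = \<epsilon> * ((L\<^sup>2 - 1) * (\<epsilon> * C))"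
      by (simp only: power2_eq_square mult_ac)
    ultimately show ?thesis by linarith
  qed
  have near: "dist (?\<Theta> ((1 / a) *\<^sub>R x)) (?\<Theta> ((1 / b) *\<^sub>R x)) < \<kappa>"
    if "norm x \<le> R" "1 \<le> a" "a \<le> L" "1 \<le> b" "b \<le> L" for a b x
  proof (rule d)
    have in_ball: "norm ((1 / c) *\<^sub>R x) \<le> R" if "1 \<le> c" for c
    proof -
      have "norm ((1 / c) *\<^sub>R x) \<le> 1 * norm x"
        unfolding norm_scaleR using that by (intro mult_right_mono) auto
      then show ?thesis using \<open>norm x \<le> R\<close> by simp
    qed
    show "(1 / a) *\<^sub>R x \<in> cball 0 R" "(1 / b) *\<^sub>R x \<in> cball 0 R"
      using in_ball that by auto
    have range: "1 - \<tau> \<le> 1 / c" "1 / c \<le> 1" if "1 \<le> c" "c \<le> L" for c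
    proof -
      have "(1 - \<tau>) * c \<le> (1 - \<tau>) * (1 + \<tau>)" using that \<open>\<tau> \<le> 1\<close> by (intro mult_left_mono) (auto simp: L_def)
      also have "\<dots> \<le> 1" by (simp add: algebra_simps)
      finally show "1 - \<tau> \<le> 1 / c" using that by (simp add: le_divide_eq)
      show "1 / c \<le> 1" using that by simp
    qed
    have "dist ((1 / a) *\<^sub>R x) ((1 / b) *\<^sub>R x) = \<bar>1 / a - 1 / b\<bar> * norm x"
      by (simp only: dist_norm scaleR_left_diff_distrib[symmetric] norm_scaleR)
    also have "\<dots> \<le> \<tau> * R"
    proof (rule mult_mono)
      show "\<bar>1 / a - 1 / b\<bar> \<le> \<tau>"
        using range(1)[OF that(2,3)] range(2)[OF that(2,3)] range(1)[OF that(4,5)] range(2)[OF that(4,5)]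
        by linarith
    qed (use that \<open>\<tau> > 0\<close> in auto)
    finally show "dist ((1 / a) *\<^sub>R x) ((1 / b) *\<^sub>R x) < d" using \<tau>R by simp
  qed
  define V where "V x = (u x - L\<^sup>2 * u ((1 / L) *\<^sub>R x)) / (L\<^sup>2 - 1)" for x
  have V\<Theta>: "\<exists>\<xi>. 1 < \<xi> \<and> \<xi> < L \<and> V x = ?\<Theta> ((1 / \<xi>) *\<^sub>R x)" for x
  proof -
    obtain \<xi> where \<xi>: "1 < \<xi>" "\<xi> < L"
      "u x - L\<^sup>2 * u ((1 / L) *\<^sub>R x) = (L\<^sup>2 - 1) * ?\<Theta> ((1 / \<xi>) *\<^sub>R x)"
      using dilation_difference[OF C1 \<open>L > 1\<close>] by blast
    have "V x = ?\<Theta> ((1 / \<xi>) *\<^sub>R x)" unfolding V_def \<xi>(3) using \<open>L\<^sup>2 > 1\<close> by simp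
    with \<xi> show ?thesis by blast
  qed
  have contV: "continuous_on S (\<lambda>x. V x - \<epsilon> * \<psi> x)" for S
    unfolding V_def \<psi>_def barrier_def
    using \<open>K > 0\<close> \<open>L\<^sup>2 > 1\<close>
    by (intro continuous_intros continuous_on_compose2[OF C1_continuous[OF C1, of UNIV]] C1_continuous[OF C1]) auto
  have Vz: "?\<Theta> 0 + 2 * \<gamma> \<le> V z - \<epsilon> * \<psi> z"
  proof -
    obtain \<xi> where "1 < \<xi>" "\<xi> < L" "V z = ?\<Theta> ((1 / \<xi>) *\<^sub>R z)" using V\<Theta> by blast
    then have "dist (V z) (?\<Theta> z) < \<kappa>"
      using near[of z \<xi> 1] \<open>norm z \<le> R\<close> \<open>L > 1\<close> by simp
    then have "\<bar>V z - ?\<Theta> z\<bar> < \<gamma>" by (simp add: \<kappa>_def dist_real_def)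
    then have "V z \<ge> ?\<Theta> z - \<gamma>" by linarith
    moreover have "?\<Theta> z = ?\<Theta> 0 + 4 * \<gamma>" by (simp add: \<gamma>_def field_simps)
    ultimately show ?thesis using \<epsilon>z by linarith
  qed
  obtain x where xR: "x \<in> cball 0 R" and xmax: "\<And>y. y \<in> cball 0 R \<Longrightarrow> V y - \<epsilon> * \<psi> y \<le> V x - \<epsilon> * \<psi> x"
  proof -
    have "cball (0 :: real ^ 'n) R \<noteq> {}" using \<open>R \<ge> 0\<close> by simp
    from continuous_attains_sup[OF compact_cball this contV] show ?thesis using that by blast
  qed
  have xz: "V z - \<epsilon> * \<psi> z \<le> V x - \<epsilon> * \<psi> x" using xmax \<open>norm z \<le> R\<close> by simp
  have max: "V y - \<epsilon> * \<psi> y \<le> V x - \<epsilon> * \<psi> x" for y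
  proof (cases "y \<in> cball 0 R")
    case False
    then have "sqrt ((M + \<bar>?\<Theta> 0\<bar>) / (\<epsilon> * \<eta>)) \<le> norm y"
      using norm_ge_zero[of z] by (simp add: R_def del: norm_ge_zero)
    then have "(M + \<bar>?\<Theta> 0\<bar>) / (\<epsilon> * \<eta>) \<le> y \<bullet> y"
      using norm_ge_zero[of y] by (simp add: dot_square_norm sqrt_le_D)
    then have "M + \<bar>?\<Theta> 0\<bar> \<le> \<epsilon> * (\<eta> * (y \<bullet> y))"
      using \<open>\<epsilon> > 0\<close> \<open>\<eta> > 0\<close> by (simp add: divide_le_eq mult_ac)
    also have "\<dots> \<le> \<epsilon> * \<psi> y" using \<psi>_lower[of y] \<open>\<epsilon> > 0\<close> by (intro mult_left_mono) auto
    finally have "M + \<bar>?\<Theta> 0\<bar> \<le> \<epsilon> * \<psi> y" .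
    moreover have "V y \<le> M" using V\<Theta>[of y] M by (metis abs_le_iff)
    ultimately have "V y - \<epsilon> * \<psi> y \<le> ?\<Theta> 0" by linarith
    then show ?thesis using Vz xz \<open>\<gamma> > 0\<close> by linarith
  qed (rule xmax)
  obtain \<xi> where \<xi>: "1 < \<xi>" "\<xi> < L" "V x = ?\<Theta> ((1 / \<xi>) *\<^sub>R x)" using V\<Theta> by blast
  have "norm x > \<delta>"
  proof (rule ccontr)
    assume "\<not> norm x > \<delta>"
    moreover have "norm ((1 / \<xi>) *\<^sub>R x) \<le> 1 * norm x"
      unfolding norm_scaleR using \<xi>(1) by (intro mult_right_mono) auto
    ultimately have "norm ((1 / \<xi>) *\<^sub>R x) \<le> \<delta>" by linarith
    then have "V x \<le> ?\<Theta> 0 + \<gamma>" unfolding \<xi>(3) by (rule \<delta>(2))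
    moreover have "0 \<le> \<epsilon> * \<psi> x" using \<psi>_nonneg \<open>\<epsilon> > 0\<close> by simp
    ultimately show False using Vz xz \<open>\<gamma> > 0\<close> by linarith
  qed
  let ?y = "(1 / L) *\<^sub>R x"
  obtain b \<beta> where b: "eigenbasis (hessian u ?y) b \<beta>"
    using self_adjoint_eigenbasis[OF hessian_self_adjoint[OF u]] by blast
  have on: "b i \<bullet> b j = (if i = j then 1 else 0)" for i j using b by (simp add: eigenbasis_def)
  let ?P = "barrier_hess K \<eta> x"
  have sup: "(\<Sum>j\<in>UNIV. (b j \<bullet> (?P *v b j)) / (1 + (\<beta> j)\<^sup>2)) - x \<bullet> barrier_grad K \<eta> x / 2 \<le> - \<eta>"
  proof (rule barrier_strict_supersolution[where \<Lambda> = \<Lambda>, OF \<open>K > 0\<close> \<open>\<eta> > 0\<close> _ on])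
    show "\<eta> * (2 * ?n + 1) \<le> exp (- K * (2 * ?n + 1))"
      by (simp add: \<eta>_def add_pos_nonneg)
    assume "x \<bullet> x \<le> 2 * ?n + 1"
    then have "norm x \<le> sqrt (2 * ?n + 1)" by (simp add: norm_eq_sqrt_inner)
    moreover have "norm ?y \<le> norm x" using \<open>L > 1\<close> by (simp add: divide_le_eq mult_le_cancel_left1)
    ultimately have "\<forall>j. \<bar>\<beta> j\<bar> \<le> \<Lambda>" using \<Lambda>[OF _ b] by simp
    moreover have "\<delta>\<^sup>2 \<le> x \<bullet> x"
      using \<open>norm x > \<delta>\<close> \<delta>(1) by (simp add: dot_square_norm)
    then have "2 * K * \<delta>\<^sup>2 \<le> 2 * K * (x \<bullet> x)" using \<open>K > 0\<close> by (intro mult_left_mono) auto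
    moreover have "2 * K * \<delta>\<^sup>2 = (?n + 1) * (1 + \<Lambda>\<^sup>2)" using \<delta>(1) by (simp add: K_def)
    ultimately show "(\<forall>j. \<bar>\<beta> j\<bar> \<le> \<Lambda>) \<and> (?n + 1) * (1 + \<Lambda>\<^sup>2) \<le> 2 * K * (x \<bullet> x)"
      by simp
  qed
  have normP: "(\<Sum>j\<in>UNIV. (norm (?P *v b j))\<^sup>2) \<le> C"
  proof -
    have "(norm (?P *v b j))\<^sup>2 \<le> (2 * (1 + \<eta>) + 4 * K * R\<^sup>2)\<^sup>2" for j
      using norm_barrier_hess_le[OF \<open>K > 0\<close> \<open>\<eta> > 0\<close>, of x R "b j"] xR on[of j j]
      by (intro power_mono) (auto simp: norm_eq_1[THEN iffD2])
    then have "(\<Sum>j\<in>UNIV. (norm (?P *v b j))\<^sup>2) \<le> (\<Sum>j::'n\<in>UNIV. (2 * (1 + \<eta>) + 4 * K * R\<^sup>2)\<^sup>2)"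
      by (rule sum_mono)
    then show ?thesis by (simp add: C_def)
  qed
  have "?\<Theta> ?y - V x \<le> \<epsilon> * ((\<Sum>j\<in>UNIV. (b j \<bullet> (?P *v b j)) / (1 + (\<beta> j)\<^sup>2)) - x \<bullet> barrier_grad K \<eta> x / 2)
      + (L\<^sup>2 - 1) * \<epsilon>\<^sup>2 * (\<Sum>j\<in>UNIV. (norm (?P *v b j))\<^sup>2)"
    using \<open>K > 0\<close>
    by (intro inequality_at_maximum[OF u eq \<open>L > 1\<close> V_def barrier_line barrier_grad_line
          barrier_hess_self_adjoint max[unfolded \<psi>_def] b]) simp
  also have "\<dots> \<le> \<epsilon> * (- \<eta>) + (L\<^sup>2 - 1) * \<epsilon>\<^sup>2 * C"
    using sup normP \<open>\<epsilon> > 0\<close> \<open>L > 1\<close> by (intro add_mono mult_left_mono) auto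
  finally have "?\<Theta> ?y - V x \<le> - (\<epsilon> * \<eta> / 2)" using small by linarith
  moreover have "dist (?\<Theta> ?y) (V x) < \<kappa>"
    unfolding \<xi>(3) using near[of x L \<xi>] xR \<xi> \<open>L > 1\<close> by simp
  then have "\<bar>?\<Theta> ?y - V x\<bar> < \<epsilon> * \<eta> / 2" by (simp add: dist_real_def \<kappa>_def)
  ultimately show False by linarith
qed

lemma partial_deriv_uminus:
  assumes "C1 f"
  shows "partial_deriv i (\<lambda>x. - f x) = (\<lambda>x. - partial_deriv i f x)"
proof
  fix x
  have "((\<lambda>t. - f (x + t *\<^sub>R axis i 1)) has_real_derivative - partial_deriv i f (x + 0 *\<^sub>R axis i 1)) (at 0)"
    by (intro DERIV_minus C1_partial_line assms)
  then show "partial_deriv i (\<lambda>x. - f x) x = - partial_deriv i f x"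
    by (simp add: partial_deriv_def[of i "\<lambda>x. - f x"] DERIV_imp_deriv)
qed

lemma C1_uminus: "C1 f \<Longrightarrow> C1 (\<lambda>x. - f x)"
  by (simp add: C1_def[of "\<lambda>x. - f x"] partial_deriv_uminus continuous_partial_deriv continuous_on_minus)
    (simp add: C1_def differentiable_minus)

lemma C2_uminus: "C2 f \<Longrightarrow> C2 (\<lambda>x. - f x)"
  by (simp add: C2_def C1_uminus partial_deriv_uminus)

lemma hessian_uminus: "C2 f \<Longrightarrow> hessian (\<lambda>x. - f x) x = - hessian f x"
  by (simp add: C2_def hessian_def partial_deriv_uminus vec_eq_iff)

lemma shrinker_potential_uminus: "C1 f \<Longrightarrow> shrinker_potential (\<lambda>x. - f x) x = - shrinker_potential f x"
  by (simp add: shrinker_potential_def partial_deriv_uminus sum_negf)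

lemma shrinker_potential_constant:
  fixes u :: "real ^ 'n::finite \<Rightarrow> real"
  assumes u: "C2 u" and eq: "\<And>x. phase (hessian u x) = shrinker_potential u x"
  shows "shrinker_potential u z = shrinker_potential u 0"
proof (rule antisym)
  show "shrinker_potential u z \<le> shrinker_potential u 0"
    using assms by (rule shrinker_potential_le_origin)
  have C1: "C1 u" using u by (rule C2_imp_C1)
  have "shrinker_potential (\<lambda>x. - u x) z \<le> shrinker_potential (\<lambda>x. - u x) 0"
    using C2_uminus[OF u]
    by (rule shrinker_potential_le_origin)
      (simp add: hessian_uminus[OF u] phase_uminus[OF hessian_self_adjoint[OF u]] shrinker_potential_uminus[OF C1] eq)
  then show "shrinker_potential u 0 \<le> shrinker_potential u z"
    by (simp add: shrinker_potential_uminus[OF C1])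
qed

text \<open>
  For constant \<open>\<Theta> = c\<close> the dilation formula says that \<open>u + c\<close> is homogeneous of degree two.  Its
  second derivative along a ray is then constant on the open ray, and continuity of the Hessian lets
  the value be read off at the origin.
\<close>
lemma quadratic_if_shrinker_potential_constant:
  fixes u :: "real ^ 'n::finite \<Rightarrow> real"
  assumes u: "C2 u" and const: "\<And>z. shrinker_potential u z = c"
  shows "u x = x \<bullet> (hessian u 0 *v x) / 2 - c"
proof -
  have C1: "C1 u" using u by (rule C2_imp_C1)
  have hom: "u (s *\<^sub>R x) = s\<^sup>2 * (u x + c) - c" if s: "0 < s" "s < 1" for s
  proof -
    have "1 < 1 / s" using s by simp
    then obtain \<xi> where "u x - (1 / s)\<^sup>2 * u ((1 / (1 / s)) *\<^sub>R x)
        = ((1 / s)\<^sup>2 - 1) * shrinker_potential u ((1 / \<xi>) *\<^sub>R x)"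
      using dilation_difference[OF C1, of "1 / s" x] by blast
    then have "u x - (1 / s)\<^sup>2 * u (s *\<^sub>R x) = ((1 / s)\<^sup>2 - 1) * c" by (simp add: const)
    then show ?thesis using s by (simp add: field_simps)
  qed
  have first: "(\<Sum>j\<in>UNIV. x $ j * partial_deriv j u (s *\<^sub>R x)) = 2 * s * (u x + c)" if s: "s \<in> {0<..<1}" for s
  proof -
    have "((\<lambda>s. u (0 + s *\<^sub>R x)) has_real_derivative (\<Sum>j\<in>UNIV. x $ j * partial_deriv j u (0 + s *\<^sub>R x))) (at s)"
      by (rule C1_line[OF C1])
    moreover have "((\<lambda>s. s\<^sup>2 * (u x + c) - c) has_real_derivative 2 * s * (u x + c)) (at s)"
      by (auto intro!: derivative_eq_intros)
    then have "((\<lambda>s. u (0 + s *\<^sub>R x)) has_real_derivative 2 * s * (u x + c)) (at s)"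
      by (rule has_field_derivative_transform_within_open[where S = "{0<..<1}"]) (use s hom in auto)
    ultimately show ?thesis using DERIV_unique by fastforce
  qed
  have second: "x \<bullet> (hessian u (s *\<^sub>R x) *v x) = 2 * (u x + c)" if s: "s \<in> {0<..<1}" for s
  proof -
    have "((\<lambda>s. \<Sum>j\<in>UNIV. x $ j * partial_deriv j u (0 + s *\<^sub>R x)) has_real_derivative
        x \<bullet> (hessian u (0 + s *\<^sub>R x) *v x)) (at s)"
      by (rule C2_line_second[OF u])
    moreover have "((\<lambda>s. 2 * s * (u x + c)) has_real_derivative 2 * (u x + c)) (at s)"
      by (auto intro!: derivative_eq_intros)
    then have "((\<lambda>s. \<Sum>j\<in>UNIV. x $ j * partial_deriv j u (0 + s *\<^sub>R x)) has_real_derivative 2 * (u x + c)) (at s)"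
      by (rule has_field_derivative_transform_within_open[where S = "{0<..<1}"]) (use s first in auto)
    ultimately show ?thesis using DERIV_unique by fastforce
  qed
  have "continuous_on UNIV (\<lambda>s. x \<bullet> (hessian u (s *\<^sub>R x) *v x))"
    unfolding inner_vec_def matrix_vector_mult_def vec_lambda_beta
    by (intro continuous_intros continuous_on_compose2[OF continuous_on_hessian[OF u, of UNIV]]) auto
  then have "((\<lambda>s. x \<bullet> (hessian u (s *\<^sub>R x) *v x)) \<longlongrightarrow> x \<bullet> (hessian u (0 *\<^sub>R x) *v x)) (at_right 0)"
    by (meson UNIV_I continuous_on_def tendsto_within_subset subset_UNIV)
  moreover have "\<forall>\<^sub>F s in at_right 0. x \<bullet> (hessian u (s *\<^sub>R x) *v x) = 2 * (u x + c)"
    using eventually_at_right_less[of 0] eventually_at_right_real[of 0 1] second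
    by (auto elim: eventually_mono)
  then have "((\<lambda>s. x \<bullet> (hessian u (s *\<^sub>R x) *v x)) \<longlongrightarrow> 2 * (u x + c)) (at_right 0)"
    by (rule tendsto_eventually)
  ultimately have "x \<bullet> (hessian u (0 *\<^sub>R x) *v x) = 2 * (u x + c)"
    by (rule tendsto_unique[rotated]) simp
  then show ?thesis by (simp add: add_divide_distrib)
qed

theorem theorem1p8:
  fixes u :: "real ^ 'n::finite \<Rightarrow> real"
    and lam :: "'n \<Rightarrow> real ^ 'n \<Rightarrow> real"
  assumes C2: "C2 u"
    and convex_or_concave: "convex_on UNIV u \<or> concave_on UNIV u"
    and eigenvalues: "\<And>x. eigenvalues_of (hessian u x) (\<lambda>i. lam i x)"
    and equation: "\<And>x. (\<Sum>i\<in>UNIV. arctan (lam i x))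
                     = - u x + 1 / 2 * (\<Sum>i\<in>UNIV. x $ i * partial_deriv i u x)"
  shows "quadratic_polynomial u"
proof -
  have "phase (hessian u x) = shrinker_potential u x" for x
    using phase_eq[OF eigenvalues[of x]] equation[of x] by (simp add: shrinker_potential_def)
  from shrinker_potential_constant[OF C2 this]
  have "u x = x \<bullet> (hessian u 0 *v x) / 2 - shrinker_potential u 0" for x
    by (rule quadratic_if_shrinker_potential_constant[OF C2])
  moreover have "x \<bullet> (hessian u 0 *v x) / 2 = (\<Sum>i\<in>UNIV. \<Sum>j\<in>UNIV. hessian u 0 $ i $ j / 2 * x $ i * x $ j)" for x
    by (simp add: inner_vec_def matrix_vector_mult_def sum_distrib_left sum_divide_distrib mult_ac)
  ultimately have "\<forall>x. u x = (\<Sum>i\<in>UNIV. \<Sum>j\<in>UNIV. hessian u 0 $ i $ j / 2 * x $ i * x $ j)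
      + (\<Sum>i\<in>UNIV. 0 * x $ i) + - shrinker_potential u 0"
    by simp
  then show ?thesis
    unfolding quadratic_polynomial_def
    by (intro exI[of _ "\<lambda>i j. hessian u 0 $ i $ j / 2"] exI[of _ "\<lambda>i. 0"] exI[of _ "- shrinker_potential u 0"])
qed

end
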